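(* Consider the integer sparse recovery problem under the following model. Let $b=Mz^*+\epsilon$, where the input matrix $M\in\mathbb{R}^{n\times d}$ consists of i.i.d. random entries drawn from $\mathcal{SG}(1)$; where the ground truth vector is $z^*=\begin{pmatrix}a\\0_{d-\sigma}\end{pmatrix}$ with $a\in\{\pm1\}^\sigma$; and where the noise vector $\epsilon\in\mathbb{R}^n$ is centered and is sub-Gaussian independent of $M$, with $\epsilon_i\stackrel{\text{i.i.d.}}{\sim}\mathcal{SG}(\varrho^2)$. Then there exists an absolute constant $C$ such that when $$n\ge C\big(\sigma^2+\varrho^2\big)\log(d),$$ (SILS'-SDP) recovers $z^*$ with high probability as $(n,d)\to\infty$.
   Context: $n,d,\sigma$ are positive integers with $\sigma\le d$, and $A:=\begin{pmatrix}-b&M\end{pmatrix}\in\mathbb{R}^{n\times(1+d)}$. In the integer sparse recovery problem, the input $(M,b,\sigma)$ satisfies $b=Mz^*+\epsilon$ for some unknown $z^*\in\{0,\pm1\}^d$ with known number $\sigma$ of nonzero entries and some unknown noise vector $\epsilon$, and the goal is to recover $z^*$ correctly. (SILS'-SDP): minimize $\frac1n\operatorname{tr}(A^\top AW)$ over symmetric positive semidefinite $W\in\mathbb{R}^{(1+d)\times(1+d)}$ subject to $W_{11}=1$, $\operatorname{tr}(W_x)=\sigma$, $1_d^\top|W_x|1_d\le\sigma^2$, $\operatorname{diag}(W_x)\le1_d$ (entrywise), where $W_x$ is $W$ with first row and column deleted, $|W_x|$ is the entrywise absolute value, $\operatorname{diag}(W_x)$ is the vector of diagonal entries of $W_x$,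 and $1_k$, $0_k$ are the all-ones and all-zeros vectors of length $k$. "(SILS'-SDP) recovers $z^*$" means: $z^*\in\{0,\pm1\}^d$ and (SILS'-SDP) has a unique optimal solution, namely the rank-one matrix $W^*=\begin{pmatrix}1 \\ z^*\end{pmatrix}\begin{pmatrix}1 \\ z^*\end{pmatrix}^\top$. "With high probability" means with probability at least $1-\mathcal{O}(1/d)-\mathcal{O}(\exp(-c_0\sigma))$ for some absolute constant $c_0>0$. A random variable $X\in\mathbb{R}$ is sub-Gaussian with parameter $L$, written $X\sim\mathcal{SG}(L^2)$, if $\mathbb{E}\exp\{t(X-\mathbb{E}X)\}\le\exp(t^2L^2/2)$ for all $t\in\mathbb{R}$. A random vector is centered if its mean is the zero vector; a centered random vector $X$ is sub-Gaussian with parameter $L$ if $\mathbb{E}\exp(tX^\top x)\le\exp(t^2L^2/2)$ for all $t\in\mathbb{R}$ and all unit vectors $x$.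
   Formalization: The entries of M must have variance at least some v>0 and mean at most μ in absolute value; C depends on v and μ only (absolute for mean 0, variance 1). Without this the claim fails: the zero law is SG(1) and gives M=0, and a large mean amplifies the noise. *)

theory Defs
  imports
    "HOL-Probability.Probability"
    "Jordan_Normal_Form.Matrix"
    "Jordan_Normal_Form.Determinant"
begin

hide_const (open) Finite_Cartesian_Product.vec Finite_Cartesian_Product.mat
  Finite_Cartesian_Product.row Finite_Cartesian_Product.column
  Determinants.det Determinants.trace
unbundle no vec_syntax
unbundle no inner_syntax

text \<open>
  Matrices and vectors are those of \<^theory>\<open>Jordan_Normal_Form.Matrix\<close>, since the dimensions are
  quantified inside the statements. Indices start at 0: the index of the first row and column
  (written 1 in the usual notation) is 0 here.
\<close>

definition trace :: "real mat \<Rightarrow> real" where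
  "trace A = (\<Sum>i<dim_row A. A $$ (i, i))"

definition ones :: "nat \<Rightarrow> real vec" where
  "ones k = vec k (\<lambda>_. 1)"

definition psd :: "nat \<Rightarrow> real mat \<Rightarrow> bool" where
  "psd k W \<longleftrightarrow> W \<in> carrier_mat k k \<and> transpose_mat W = W \<and>
     (\<forall>x\<in>carrier_vec k. x \<bullet> (W *\<^sub>v x) \<ge> 0)"

text \<open>The block matrix whose first column is the negated right-hand side \<open>-b\<close>, followed by \<open>M\<close>.\<close>

definition data_mat :: "real mat \<Rightarrow> real vec \<Rightarrow> real mat" where
  "data_mat M b = mat (dim_row M) (1 + dim_col M)
     (\<lambda>(i, j). if j = 0 then - (b $ i) else M $$ (i, j - 1))"

definition sdp_objective :: "real mat \<Rightarrow> real vec \<Rightarrow> real mat \<Rightarrow> real" where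
  "sdp_objective M b W =
     (1 / real (dim_row M)) * trace (transpose_mat (data_mat M b) * data_mat M b * W)"

abbreviation minor_x :: "real mat \<Rightarrow> real mat" where
  "minor_x W \<equiv> mat_delete W 0 0"

definition sdp_feasible :: "nat \<Rightarrow> nat \<Rightarrow> real mat \<Rightarrow> bool" where
  "sdp_feasible d \<sigma> W \<longleftrightarrow>
     psd (1 + d) W \<and>
     W $$ (0, 0) = 1 \<and>
     trace (minor_x W) = real \<sigma> \<and>
     ones d \<bullet> (map_mat abs (minor_x W) *\<^sub>v ones d) \<le> (real \<sigma>)\<^sup>2 \<and>
     (\<forall>i<d. minor_x W $$ (i, i) \<le> 1)"

definition sdp_optimal :: "real mat \<Rightarrow> real vec \<Rightarrow> nat \<Rightarrow> real mat \<Rightarrow> bool" where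
  "sdp_optimal M b \<sigma> W \<longleftrightarrow>
     sdp_feasible (dim_col M) \<sigma> W \<and>
     (\<forall>W'. sdp_feasible (dim_col M) \<sigma> W' \<longrightarrow> sdp_objective M b W \<le> sdp_objective M b W')"

definition lifted :: "real vec \<Rightarrow> real mat" where
  "lifted z = mat (1 + dim_vec z) (1 + dim_vec z) (\<lambda>(i, j). vCons 1 z $ i * vCons 1 z $ j)"

definition sdp_recovers :: "real mat \<Rightarrow> real vec \<Rightarrow> nat \<Rightarrow> real vec \<Rightarrow> bool" where
  "sdp_recovers M b \<sigma> z \<longleftrightarrow>
     z \<in> carrier_vec (dim_col M) \<and>
     (\<forall>i<dim_col M. z $ i \<in> {-1, 0, 1}) \<and>
     {W. sdp_optimal M b \<sigma> W} = {lifted z}"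

text \<open>
  The integrability clauses express that the expectations exist: the Bochner integral of a
  function that is not integrable is 0 by convention.
\<close>

definition subgaussian :: "'a measure \<Rightarrow> ('a \<Rightarrow> real) \<Rightarrow> real \<Rightarrow> bool" where
  "subgaussian P X L \<longleftrightarrow>
     integrable P X \<and>
     (\<forall>t. integrable P (\<lambda>w. exp (t * (X w - integral\<^sup>L P X))) \<and>
          integral\<^sup>L P (\<lambda>w. exp (t * (X w - integral\<^sup>L P X))) \<le> exp (t\<^sup>2 * L\<^sup>2 / 2))"

text \<open>A probability distribution on the real line that is sub-Gaussian with parameter \<open>L\<close>.\<close>

definition subgaussian_law :: "real measure \<Rightarrow> real \<Rightarrow> bool" where
  "subgaussian_law D L \<longleftrightarrow> prob_space D \<and> sets D = sets borel \<and> subgaussian D (\<lambda>x. x) L"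

definition law_mean :: "real measure \<Rightarrow> real" where
  "law_mean D = integral\<^sup>L D (\<lambda>x. x)"

definition law_variance :: "real measure \<Rightarrow> real" where
  "law_variance D = integral\<^sup>L D (\<lambda>x. (x - law_mean D)\<^sup>2)"

text \<open>
  Being sub-Gaussian with parameter 1 bounds the variance from above only: it admits \<open>M = 0\<close> almost
  surely, for which nothing can be recovered. It also leaves the mean free, and no constant works
  uniformly in the mean, because a large mean amplifies the average of the noise. The usual
  normalization of the entries is mean 0 and variance 1; more generally a lower bound on the variance and an
  upper bound on the absolute value of the mean enter the choice of the sample size constant.
\<close>

text \<open>
  The joint distribution of the \<open>n * d\<close> entries of \<open>M\<close> and the \<open>n\<close> entries of \<open>\<epsilon>\<close>. Being a product
  measure, it makes the entries of \<open>M\<close> independent with common law \<open>D\<close>, the entries of \<open>\<epsilon>\<close>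
  independent with common law \<open>E\<close>, and \<open>\<epsilon>\<close> independent of \<open>M\<close>.
\<close>

definition sample_measure ::
    "nat \<Rightarrow> nat \<Rightarrow> real measure \<Rightarrow> real measure \<Rightarrow> ((nat \<times> nat \<Rightarrow> real) \<times> (nat \<Rightarrow> real)) measure" where
  "sample_measure n d D E =
     PiM ({..<n} \<times> {..<d}) (\<lambda>_. D) \<Otimes>\<^sub>M PiM {..<n} (\<lambda>_. E)"

definition recovery_event ::
    "nat \<Rightarrow> nat \<Rightarrow> nat \<Rightarrow> real measure \<Rightarrow> real measure \<Rightarrow> real vec
      \<Rightarrow> ((nat \<times> nat \<Rightarrow> real) \<times> (nat \<Rightarrow> real)) set" where
  "recovery_event n d \<sigma> D E z =
     {(m, e) \<in> space (sample_measure n d D E).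
        let M = mat n d m; \<epsilon> = vec n e; b = M *\<^sub>v z + \<epsilon>
        in sdp_recovers M b \<sigma> z}"

end

theory Submission
  imports Defs
begin

text \<open>
  Let \<open>z\<close> be the planted vector with support \<open>S\<close>, let \<open>W\<close> be feasible with first column \<open>(1, w)\<close> and
  minor \<open>W\<^sub>x\<close>, and put \<open>H = W\<^sub>x - w z\<^sup>T - z w\<^sup>T + z z\<^sup>T\<close>, which is positive semidefinite and vanishes
  only at the target. The objective at \<open>W\<close> exceeds that at the target by
  \<open>(tr (M\<^sup>T M H) - 2 \<epsilon>\<^sup>T M (w - z)) / n\<close>. Put \<open>t = tr H / 2 = \<sigma> - w \<bullet> z\<close>. The constraints force
  \<open>w - z\<close> to have \<open>l\<^sub>1\<close> norm at most \<open>2 t\<close> and \<open>H\<close> to have entrywise \<open>l\<^sub>1\<close> norm at most \<open>6 \<sigma> t\<close>.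
  If \<open>m\<close> and \<open>v\<close> are mean and variance of the entries, then \<open>M\<^sup>T M / n\<close> is entrywise within
  \<open>v / (24 \<sigma>)\<close> of its expectation \<open>v I + m\<^sup>2 1 1\<^sup>T\<close> (on the diagonal only the lower bound matters) and
  \<open>M\<^sup>T \<epsilon> / n\<close> has entries at most \<open>v / 48\<close>, except with probability \<open>8 / d\<close>, by Bernstein type bounds
  on \<open>O(d\<^sup>2)\<close> averages. Then the difference is positive unless \<open>t = 0\<close>, and \<open>t = 0\<close> means \<open>H = 0\<close>.
\<close>

section \<open>Feasible points and the cone condition\<close>

text \<open>The form at \<open>e_i + s e_j\<close> is \<open>H i i + 2 s H i j + s^2 H j j\<close>;
  nonnegativity at \<open>s = 1\<close> and \<open>s = -1\<close> bounds \<open>H i j\<close> on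
  both sides.\<close>

lemma psd_form_entry_bound:
  fixes H :: "nat \<Rightarrow> nat \<Rightarrow> real"
  assumes psd: "\<And>x. 0 \<le> (\<Sum>i<d. \<Sum>j<d. x i * H i j * x j)"
    and sym: "\<And>i j. i < d \<Longrightarrow> j < d \<Longrightarrow> H i j = H j i"
    and i: "i < d" and j: "j < d"
  shows "\<bar>H i j\<bar> \<le> (H i i + H j j) / 2"
proof -
  have diag: "0 \<le> H k k" if "k < d" for k
  proof -
    have "(\<Sum>i<d. \<Sum>j<d. (if i = k then 1 else 0) * H i j * (if j = k then 1 else 0))
       = (\<Sum>i<d. if i = k then H i k else 0)"
      using that by (intro sum.cong refl) (auto simp: if_distrib cong: if_cong)
    then show ?thesis using psd[of "\<lambda>i. if i = k then 1 else 0"] that by simp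
  qed
  show ?thesis
  proof (cases "i = j")
    case True
    then show ?thesis using diag[OF i] by simp
  next
    case False
    have form: "0 \<le> H i i + 2 * s * H i j + s * s * H j j" for s
    proof -
      define x where "x k = (if k = i then 1 else if k = j then s else 0)" for k
      have inner: "(\<Sum>l<d. x k * H k l * x l) = x k * (H k i + s * H k j)" for k
      proof -
        have "(\<Sum>l<d. x k * H k l * x l) = (\<Sum>l\<in>{i, j}. x k * H k l * x l)"
          using i j by (intro sum.mono_neutral_right) (auto simp: x_def)
        then show ?thesis using False by (simp add: x_def algebra_simps)
      qed
      have "(\<Sum>k<d. \<Sum>l<d. x k * H k l * x l) = (\<Sum>k\<in>{i, j}. x k * (H k i + s * H k j))"
        unfolding inner using i j by (intro sum.mono_neutral_right) (auto simp: x_def)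
      also have "\<dots> = H i i + 2 * s * H i j + s * s * H j j"
        using False sym[OF j i] by (simp add: x_def algebra_simps)
      finally show ?thesis using psd[of x] by simp
    qed
    show ?thesis using form[of 1] form[of "-1"] by (simp add: abs_if)
  qed
qed

text \<open>
  Here \<open>w\<close> is the first column of a feasible matrix without its top entry 1, and \<open>V\<close> is the minor
  \<open>W\<^sub>x\<close>; the matrix is positive semidefinite on the vectors \<open>(\<alpha>, x)\<close>. In this context, \<open>H\<close> below is
  the congruence of the full matrix by \<open>(-z, I)\<close>, so its form at \<open>x\<close> is the full form at
  \<open>\<alpha> = - (z \<bullet> x)\<close>.
\<close>

locale sdp_point =
  fixes d \<sigma> :: nat and z w :: "nat \<Rightarrow> real" and V :: "nat \<Rightarrow> nat \<Rightarrow> real"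
  assumes \<sigma>_le: "\<sigma> \<le> d"
    and z_sq: "\<And>i. i < \<sigma> \<Longrightarrow> z i * z i = 1"
    and z_zero: "\<And>i. \<sigma> \<le> i \<Longrightarrow> z i = 0"
    and sym: "\<And>i j. i < d \<Longrightarrow> j < d \<Longrightarrow> V i j = V j i"
    and psd_form: "\<And>\<alpha> x. 0 \<le> \<alpha> * \<alpha> + 2 * \<alpha> * (\<Sum>i<d. w i * x i) + (\<Sum>i<d. \<Sum>j<d. x i * V i j * x j)"
    and tr: "(\<Sum>i<d. V i i) = real \<sigma>"
    and l1: "(\<Sum>i<d. \<Sum>j<d. \<bar>V i j\<bar>) \<le> (real \<sigma>)\<^sup>2"
    and diag_le: "\<And>i. i < d \<Longrightarrow> V i i \<le> 1"
begin

definition H :: "nat \<Rightarrow> nat \<Rightarrow> real" where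
  "H i j = V i j - w i * z j - z i * w j + z i * z j"

text \<open>This is \<open>t\<close>, the deficit of the inner product of \<open>w\<close> and
  \<open>z\<close> from its value \<sigma> at the target, written over the support so that each
  summand is nonnegative by \<open>wz_le\<close>.\<close>

definition gap :: real where
  "gap = (\<Sum>i<\<sigma>. 1 - w i * z i)"

lemma split_sum: "(\<Sum>i<d. f i) = (\<Sum>i<\<sigma>. f i) + (\<Sum>i=\<sigma>..<d. f i)" for f :: "nat \<Rightarrow> real"
proof -
  have "{..<d} = {..<\<sigma>} \<union> {\<sigma>..<d}" using \<sigma>_le by auto
  then show ?thesis by (simp add: sum.union_disjoint ivl_disj_int)
qed

lemma abs_z: "i < \<sigma> \<Longrightarrow> \<bar>z i\<bar> = 1"
  by (metis abs_mult_self_eq abs_square_eq_1 power2_eq_square z_sq)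

text \<open>Schur complement of the corner entry 1: in \<alpha> the full form is smallest at minus
  the inner product of \<open>w\<close> and \<open>x\<close>, and nonnegativity there is the
  claim.\<close>

lemma square_le_form: "(\<Sum>i<d. w i * x i)\<^sup>2 \<le> (\<Sum>i<d. \<Sum>j<d. x i * V i j * x j)"
  using psd_form[of "- (\<Sum>i<d. w i * x i)" x] by (simp add: power2_eq_square)

lemma form_le_l1:
  assumes "\<And>i. i < d \<Longrightarrow> \<bar>u i\<bar> \<le> 1"
  shows "(\<Sum>i<d. \<Sum>j<d. u i * V i j * u j) \<le> (\<Sum>i<d. \<Sum>j<d. \<bar>V i j\<bar>)"
proof (intro sum_mono)
  fix i j assume "i \<in> {..<d}" "j \<in> {..<d}"
  then have "\<bar>u i\<bar> * \<bar>u j\<bar> \<le> 1" using assms by (simp add: mult_le_one)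
  then have "\<bar>V i j\<bar> * (\<bar>u i\<bar> * \<bar>u j\<bar>) \<le> \<bar>V i j\<bar> * 1" by (intro mult_left_mono) auto
  moreover have "u i * V i j * u j \<le> \<bar>V i j\<bar> * (\<bar>u i\<bar> * \<bar>u j\<bar>)"
    by (metis abs_ge_self abs_mult mult.assoc mult.commute)
  ultimately show "u i * V i j * u j \<le> \<bar>V i j\<bar>" by simp
qed

lemma sum_wz: "(\<Sum>i<d. w i * z i) = real \<sigma> - gap"
  unfolding split_sum gap_def by (simp add: z_zero sum_subtractf)

lemma sum_abs_z: "(\<Sum>i<d. \<bar>z i\<bar>) = real \<sigma>"
  unfolding split_sum by (simp add: abs_z z_zero)

text \<open>At a unit vector the Schur complement bound reads \<open>(w i)^2 \<le> V i i\<close>,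
  and the diagonal constraint caps the right side at 1.\<close>

lemma abs_w_le: "i < d \<Longrightarrow> \<bar>w i\<bar> \<le> 1"
proof -
  assume i: "i < d"
  have "(\<Sum>k<d. w k * (if k = i then 1 else 0)) = w i" using i by (simp add: if_distrib cong: if_cong)
  moreover have "(\<Sum>k<d. \<Sum>l<d. (if k = i then 1 else 0) * V k l * (if l = i then 1 else 0)) = V i i"
  proof -
    have "(\<Sum>k<d. \<Sum>l<d. (if k = i then 1 else 0) * V k l * (if l = i then 1 else 0))
       = (\<Sum>k<d. if k = i then V k i else 0)"
      using i by (intro sum.cong refl) (auto simp: if_distrib cong: if_cong)
    then show ?thesis using i by simp
  qed
  ultimately have "(w i)\<^sup>2 \<le> 1"
    using square_le_form[of "\<lambda>k. if k = i then 1 else 0"] diag_le[OF i] by simp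
  then show ?thesis by (simp add: abs_square_le_1)
qed

lemma wz_le: "i < \<sigma> \<Longrightarrow> w i * z i \<le> 1"
proof -
  assume "i < \<sigma>"
  then have "\<bar>w i * z i\<bar> \<le> 1" using abs_w_le[of i] \<sigma>_le abs_z[of i] by (simp add: abs_mult)
  then show ?thesis by simp
qed

lemma gap_nonneg: "0 \<le> gap"
  unfolding gap_def by (intro sum_nonneg) (use wz_le in auto)

text \<open>Test the Schur complement bound on the sign vector that equals \<open>z\<close> on its support and \<open>sgn w\<close> off it.\<close>

lemma w_tail_le: "(\<Sum>i=\<sigma>..<d. \<bar>w i\<bar>) \<le> gap"
proof -
  define u where "u i = (if i < \<sigma> then z i else sgn (w i))" for i
  have "(\<Sum>i<d. w i * u i)\<^sup>2 \<le> (real \<sigma>)\<^sup>2"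
  proof -
    have "\<bar>u i\<bar> \<le> 1" for i by (auto simp: u_def abs_z abs_sgn_eq)
    from order_trans[OF square_le_form order_trans[OF form_le_l1[OF this] l1]] show ?thesis .
  qed
  then have "(\<Sum>i<d. w i * u i) \<le> real \<sigma>" by (rule power2_le_imp_le) simp
  moreover have "(\<Sum>i<d. w i * u i) = real \<sigma> - gap + (\<Sum>i=\<sigma>..<d. \<bar>w i\<bar>)"
    unfolding split_sum by (simp add: u_def gap_def sum_subtractf abs_sgn[symmetric])
  ultimately show ?thesis by simp
qed

text \<open>On the support \<open>z i\<close> is a sign and \<open>w i * z i \<le> 1\<close>, so
  \<open>\<bar>w i - z i\<bar>\<close> is exactly the summand of \<open>gap\<close>. Off the support
  \<open>z\<close> vanishes and the tail of \<open>w\<close> costs at most another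
  \<open>gap\<close>.\<close>

lemma diff_l1: "(\<Sum>i<d. \<bar>w i - z i\<bar>) \<le> 2 * gap"
proof -
  have "\<bar>w i - z i\<bar> = 1 - w i * z i" if "i < \<sigma>" for i
  proof -
    have "\<bar>w i - z i\<bar> = \<bar>w i - z i\<bar> * \<bar>z i\<bar>" using abs_z[OF that] by simp
    also have "\<dots> = \<bar>w i * z i - 1\<bar>" using z_sq[OF that] by (simp flip: abs_mult add: algebra_simps)
    finally show ?thesis using wz_le[OF that] by simp
  qed
  then have "(\<Sum>i<\<sigma>. \<bar>w i - z i\<bar>) = gap" by (simp add: gap_def)
  then show ?thesis unfolding split_sum using w_tail_le by (simp add: z_zero)
qed

lemma H_sym: "i < d \<Longrightarrow> j < d \<Longrightarrow> H i j = H j i"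
  using sym by (simp add: H_def)

lemma H_form:
  "(\<Sum>i<d. \<Sum>j<d. x i * H i j * y j)
     = (\<Sum>i<d. \<Sum>j<d. x i * V i j * y j) - (\<Sum>i<d. w i * x i) * (\<Sum>i<d. z i * y i)
       - (\<Sum>i<d. z i * x i) * (\<Sum>i<d. w i * y i) + (\<Sum>i<d. z i * x i) * (\<Sum>i<d. z i * y i)"
  unfolding sum_product sum.distrib[symmetric] sum_subtractf[symmetric]
  by (intro sum.cong refl) (simp add: H_def algebra_simps)

lemma H_psd: "0 \<le> (\<Sum>i<d. \<Sum>j<d. x i * H i j * x j)"
  using psd_form[of "- (\<Sum>i<d. z i * x i)" x] unfolding H_form by (simp add: algebra_simps)

lemma H_bound: "i < d \<Longrightarrow> j < d \<Longrightarrow> \<bar>H i j\<bar> \<le> (H i i + H j j) / 2"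
  by (rule psd_form_entry_bound[OF H_psd H_sym])

lemma H_diag_nonneg: "i < d \<Longrightarrow> 0 \<le> H i i"
  using H_bound[of i i] by simp

lemma H_trace: "(\<Sum>i<d. H i i) = 2 * gap"
proof -
  have "(\<Sum>i<d. z i * z i) = real \<sigma>" unfolding split_sum by (simp add: z_zero z_sq)
  then have "(\<Sum>i<d. H i i) = real \<sigma> - 2 * (\<Sum>i<d. w i * z i) + real \<sigma>"
    using tr by (simp add: H_def sum.distrib sum_subtractf mult.commute sum_distrib_left)
  then show ?thesis by (simp add: sum_wz)
qed

text \<open>
  The block on the support is controlled by the trace. Off the support, \<open>V\<close> has only the part of the
  budget \<open>\<sigma>\<^sup>2\<close> left that the support block, of norm at least \<open>(\<sigma> - gap)\<^sup>2\<close>, does not use.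
\<close>

lemma H_l1: "(\<Sum>i<d. \<Sum>j<d. \<bar>H i j\<bar>) \<le> 6 * real \<sigma> * gap"
proof -
  define off where "off i j = (if i < \<sigma> \<and> j < \<sigma> then 0 else \<bar>V i j\<bar>)" for i j
  \<comment> \<open>Bounding each entry by the mean of its two diagonal entries sums over the block
    to \<sigma> times the trace of the block, which is at most \<open>2 * gap\<close>.\<close>
  have SS: "(\<Sum>i<\<sigma>. \<Sum>j<\<sigma>. \<bar>H i j\<bar>) \<le> 2 * real \<sigma> * gap"
  proof -
    have "(\<Sum>i<\<sigma>. \<Sum>j<\<sigma>. \<bar>H i j\<bar>) \<le> (\<Sum>i<\<sigma>. \<Sum>j<\<sigma>. (H i i + H j j) / 2)"
      using \<sigma>_le by (intro sum_mono H_bound) auto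
    also have "\<dots> = real \<sigma> * (\<Sum>i<\<sigma>. H i i)"
      by (simp add: sum.distrib add_divide_distrib flip: sum_distrib_left sum_divide_distrib)
    also have "\<dots> \<le> real \<sigma> * (\<Sum>i<d. H i i)"
      using \<sigma>_le by (intro mult_left_mono sum_mono2) (auto intro: H_diag_nonneg)
    finally show ?thesis by (simp add: H_trace mult.left_commute)
  qed
  have "(real \<sigma> - gap)\<^sup>2 \<le> (\<Sum>i<\<sigma>. \<Sum>j<\<sigma>. \<bar>V i j\<bar>)"
  proof -
    have "(real \<sigma> - gap)\<^sup>2 \<le> (\<Sum>i<d. \<Sum>j<d. z i * V i j * z j)"
      using square_le_form[of z] by (simp add: sum_wz)
    also have "\<dots> = (\<Sum>i<\<sigma>. \<Sum>j<\<sigma>. z i * V i j * z j)" by (simp add: split_sum z_zero)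
    also have "\<dots> \<le> (\<Sum>i<\<sigma>. \<Sum>j<\<sigma>. \<bar>V i j\<bar>)"
    proof (intro sum_mono)
      fix i j assume "i \<in> {..<\<sigma>}" "j \<in> {..<\<sigma>}"
      then have "\<bar>z i * V i j * z j\<bar> = \<bar>V i j\<bar>" by (simp add: abs_mult abs_z)
      then show "z i * V i j * z j \<le> \<bar>V i j\<bar>" by linarith
    qed
    finally show ?thesis .
  qed
  moreover have "(\<Sum>i<d. \<Sum>j<d. \<bar>V i j\<bar>) = (\<Sum>i<\<sigma>. \<Sum>j<\<sigma>. \<bar>V i j\<bar>) + (\<Sum>i<d. \<Sum>j<d. off i j)"
    by (simp add: split_sum off_def sum.distrib)
  \<comment> \<open>The remaining budget is
    \<open>\<sigma>^2 - (\<sigma> - gap)^2 = 2 \<sigma> gap - gap^2\<close>.\<close>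
  ultimately have off: "(\<Sum>i<d. \<Sum>j<d. off i j) \<le> 2 * real \<sigma> * gap"
    using l1 by (simp add: power2_eq_square algebra_simps) (smt (verit) mult_nonneg_nonneg gap_nonneg)
  have cross: "(\<Sum>i<d. \<Sum>j<d. \<bar>z i\<bar> * (if j < \<sigma> then 0 else \<bar>w j\<bar>)) \<le> real \<sigma> * gap"
  proof -
    have "(\<Sum>i<d. \<Sum>j<d. \<bar>z i\<bar> * (if j < \<sigma> then 0 else \<bar>w j\<bar>)) = real \<sigma> * (\<Sum>j=\<sigma>..<d. \<bar>w j\<bar>)"
      unfolding sum_product[symmetric] sum_abs_z by (simp add: split_sum)
    then show ?thesis using w_tail_le by (simp add: mult_left_mono)
  qed
  have cross': "(\<Sum>i<d. \<Sum>j<d. (if i < \<sigma> then 0 else \<bar>w i\<bar>) * \<bar>z j\<bar>) \<le> real \<sigma> * gap"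
    by (subst sum.swap) (use cross in \<open>simp add: mult.commute\<close>)
  \<comment> \<open>Outside the support block \<open>z i * z j = 0\<close> and at most one of the
    two mixed terms survives. The four parts contribute 2, 2, 1 and 1 times
    \<open>\<sigma> * gap\<close>, hence the 6.\<close>
  have "(\<Sum>i<d. \<Sum>j<d. \<bar>H i j\<bar>) \<le> (\<Sum>i<d. \<Sum>j<d. (if i < \<sigma> \<and> j < \<sigma> then \<bar>H i j\<bar> else 0) + off i j
     + \<bar>z i\<bar> * (if j < \<sigma> then 0 else \<bar>w j\<bar>) + (if i < \<sigma> then 0 else \<bar>w i\<bar>) * \<bar>z j\<bar>)"
  proof (intro sum_mono)
    fix i j
    show "\<bar>H i j\<bar> \<le> (if i < \<sigma> \<and> j < \<sigma> then \<bar>H i j\<bar> else 0) + off i j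
     + \<bar>z i\<bar> * (if j < \<sigma> then 0 else \<bar>w j\<bar>) + (if i < \<sigma> then 0 else \<bar>w i\<bar>) * \<bar>z j\<bar>"
      using abs_triangle_ineq4[of "V i j" "z i * w j"] abs_triangle_ineq4[of "V i j" "w i * z j"]
      by (auto simp: H_def off_def z_zero abs_mult)
  qed
  also have "\<dots> = (\<Sum>i<\<sigma>. \<Sum>j<\<sigma>. \<bar>H i j\<bar>) + (\<Sum>i<d. \<Sum>j<d. off i j)
     + (\<Sum>i<d. \<Sum>j<d. \<bar>z i\<bar> * (if j < \<sigma> then 0 else \<bar>w j\<bar>))
     + (\<Sum>i<d. \<Sum>j<d. (if i < \<sigma> then 0 else \<bar>w i\<bar>) * \<bar>z j\<bar>)"
    unfolding sum.distrib by (simp add: split_sum)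
  finally show ?thesis using SS off cross cross' by linarith
qed

text \<open>A zero gap kills the norm of \<open>w - z\<close> and the trace of \<open>H\<close>; the
  nonnegative diagonal of \<open>H\<close> then vanishes, and with it every entry by
  \<open>H_bound\<close>.\<close>

lemma gap_zero:
  assumes "gap = 0" "i < d" "j < d"
  shows "w i = z i" "V i j = z i * z j"
proof -
  have w: "w k = z k" if "k < d" for k
  proof -
    have "(\<Sum>i<d. \<bar>w i - z i\<bar>) = 0"
      using diff_l1 assms(1) by (simp add: order_antisym sum_nonneg)
    then show ?thesis using that by (simp add: sum_nonneg_eq_0_iff)
  qed
  have "H k k = 0" if "k < d" for k
  proof -
    have "(\<Sum>i<d. H i i) = 0" using H_trace assms(1) by simp
    then show ?thesis using that H_diag_nonneg by (subst (asm) sum_nonneg_eq_0_iff) auto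
  qed
  then have "H i j = 0" using H_bound[OF assms(2,3)] assms by simp
  then show "w i = z i" "V i j = z i * z j" using w assms by (simp_all add: H_def)
qed

text \<open>\<open>G\<close> stands for the empirical Gram matrix and \<open>g\<close> for the
  correlations of the columns with the noise. Of the expected Gram matrix, the all-ones part is
  nonnegative against \<open>H\<close> and the multiple \<open>v\<close> of the identity gives
  \<open>2 v gap\<close>. The deviation of \<open>G\<close> costs at most
  \<open>6 \<sigma> \<eta> gap\<close> and the noise at most \<open>4 \<delta> gap\<close>. On the
  diagonal a lower bound suffices because \<open>H j j \<ge> 0\<close>.\<close>

lemma objective_lower:
  assumes G_off: "\<And>j k. j < d \<Longrightarrow> k < d \<Longrightarrow> j \<noteq> k \<Longrightarrow> \<bar>G j k - m\<^sup>2\<bar> \<le> \<eta>"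
    and G_diag: "\<And>j. j < d \<Longrightarrow> m\<^sup>2 + v - \<eta> \<le> G j j"
    and g: "\<And>j. j < d \<Longrightarrow> \<bar>g j\<bar> \<le> \<delta>"
    and small: "6 * real \<sigma> * \<eta> + 4 * \<delta> < 2 * v"
    and "0 \<le> \<eta>"
    and gap: "gap \<noteq> 0"
  shows "0 < (\<Sum>j<d. \<Sum>k<d. G j k * H j k) - 2 * (\<Sum>j<d. g j * (w j - z j))"
proof -
  have pos: "0 < gap" using gap gap_nonneg by simp
  \<comment> \<open>The sign of \<delta> is read off the bound at index 0. For \<open>d = 0\<close>
    also \<open>\<sigma> = 0\<close>, and \<open>gap\<close> would be an empty sum.\<close>
  have "d \<noteq> 0" using gap \<sigma>_le by (cases d) (auto simp: gap_def)
  then have "0 \<le> \<delta>" using g[of 0] by linarith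
  have entry: "m\<^sup>2 * H j k + (if j = k then v * H j k else 0) - \<eta> * \<bar>H j k\<bar> \<le> G j k * H j k"
    if "j < d" "k < d" for j k
  proof (cases "j = k")
    case True
    then have "0 \<le> (G j j - (m\<^sup>2 + v - \<eta>)) * H j j"
      using G_diag H_diag_nonneg that by simp
    then show ?thesis using True H_diag_nonneg[OF that(1)] by (simp add: algebra_simps)
  next
    case False
    have "\<bar>(G j k - m\<^sup>2) * H j k\<bar> \<le> \<eta> * \<bar>H j k\<bar>"
      using G_off[OF that False] by (simp add: abs_mult mult_right_mono)
    then show ?thesis using False by (simp add: algebra_simps abs_le_iff)
  qed
  have "m\<^sup>2 * (\<Sum>j<d. \<Sum>k<d. H j k) + v * (\<Sum>j<d. H j j) - \<eta> * (\<Sum>j<d. \<Sum>k<d. \<bar>H j k\<bar>)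
     = (\<Sum>j<d. \<Sum>k<d. m\<^sup>2 * H j k + (if j = k then v * H j k else 0) - \<eta> * \<bar>H j k\<bar>)"
    by (simp add: sum.distrib sum_subtractf sum_distrib_left)
  also have "\<dots> \<le> (\<Sum>j<d. \<Sum>k<d. G j k * H j k)"
    using entry by (intro sum_mono) auto
  finally have 1: "m\<^sup>2 * (\<Sum>j<d. \<Sum>k<d. H j k) + v * (2 * gap) - \<eta> * (\<Sum>j<d. \<Sum>k<d. \<bar>H j k\<bar>)
     \<le> (\<Sum>j<d. \<Sum>k<d. G j k * H j k)" by (simp add: H_trace)
  have 2: "0 \<le> m\<^sup>2 * (\<Sum>j<d. \<Sum>k<d. H j k)" using H_psd[of "\<lambda>_. 1"] by simp
  have 4: "(\<Sum>j<d. g j * (w j - z j)) \<le> \<delta> * (2 * gap)"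
  proof -
    have "(\<Sum>j<d. g j * (w j - z j)) \<le> (\<Sum>j<d. \<delta> * \<bar>w j - z j\<bar>)"
    proof (intro sum_mono)
      fix j assume "j \<in> {..<d}"
      then have "\<bar>g j * (w j - z j)\<bar> \<le> \<delta> * \<bar>w j - z j\<bar>" using g by (simp add: abs_mult mult_right_mono)
      then show "g j * (w j - z j) \<le> \<delta> * \<bar>w j - z j\<bar>" by linarith
    qed
    also have "\<dots> \<le> \<delta> * (2 * gap)"
      unfolding sum_distrib_left[symmetric] using diff_l1 \<open>0 \<le> \<delta>\<close> by (rule mult_left_mono)
    finally show ?thesis .
  qed
  have 3: "\<eta> * (\<Sum>j<d. \<Sum>k<d. \<bar>H j k\<bar>) \<le> \<eta> * (6 * real \<sigma> * gap)"
    using H_l1 \<open>0 \<le> \<eta>\<close> by (rule mult_left_mono)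
  have "(6 * real \<sigma> * \<eta> + 4 * \<delta>) * gap < (2 * v) * gap"
    using small pos by (rule mult_strict_right_mono)
  then show ?thesis using 1 2 3 4 by (simp add: algebra_simps)
qed

end

section \<open>The program in coordinates\<close>

text \<open>The constraints on plain index functions, so that closedness and compactness can be
  argued coordinatewise in the product topology. Index 0 is the bordering row; the minor sits at
  successor indices.\<close>

definition feasible_fun :: "nat \<Rightarrow> nat \<Rightarrow> (nat \<times> nat \<Rightarrow> real) \<Rightarrow> bool" where
  "feasible_fun d \<sigma> g \<longleftrightarrow>
     (\<forall>i<Suc d. \<forall>j<Suc d. g (i, j) = g (j, i)) \<and>
     (\<forall>x. 0 \<le> (\<Sum>i<Suc d. \<Sum>j<Suc d. x i * g (i, j) * x j)) \<and>
     g (0, 0) = 1 \<and>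
     (\<Sum>i<d. g (Suc i, Suc i)) = real \<sigma> \<and>
     (\<Sum>i<d. \<Sum>j<d. \<bar>g (Suc i, Suc j)\<bar>) \<le> (real \<sigma>)\<^sup>2 \<and>
     (\<forall>i<d. g (Suc i, Suc i) \<le> 1)"

lemma psd_mat_iff:
  "psd k (mat k k g) \<longleftrightarrow> (\<forall>i<k. \<forall>j<k. g (i, j) = g (j, i)) \<and>
     (\<forall>x. 0 \<le> (\<Sum>i<k. \<Sum>j<k. x i * g (i, j) * x j))"
proof -
  have sym: "transpose_mat (mat k k g) = mat k k g \<longleftrightarrow> (\<forall>i<k. \<forall>j<k. g (i, j) = g (j, i))"
    by (auto simp: mat_eq_iff)
  have form: "x \<bullet> (mat k k g *\<^sub>v x) = (\<Sum>i<k. \<Sum>j<k. x $ i * g (i, j) * x $ j)"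
    if "x \<in> carrier_vec k" for x
    using that
    by (auto simp: scalar_prod_def sum_distrib_left mult.assoc atLeast0LessThan intro!: sum.cong)
  have "(\<forall>x\<in>carrier_vec k. 0 \<le> x \<bullet> (mat k k g *\<^sub>v x)) \<longleftrightarrow>
     (\<forall>x. 0 \<le> (\<Sum>i<k. \<Sum>j<k. x i * g (i, j) * x j))" (is "?L \<longleftrightarrow> ?R")
  proof
    assume L: ?L
    show ?R
    proof
      fix x :: "nat \<Rightarrow> real"
      have "0 \<le> vec k x \<bullet> (mat k k g *\<^sub>v vec k x)" using L by simp
      then show "0 \<le> (\<Sum>i<k. \<Sum>j<k. x i * g (i, j) * x j)" by (simp add: form)
    qed
  qed (simp add: form)
  then show ?thesis by (simp add: psd_def sym)
qed

lemma sdp_feasible_mat: "sdp_feasible d \<sigma> (mat (Suc d) (Suc d) g) \<longleftrightarrow> feasible_fun d \<sigma> g"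
proof -
  let ?X = "minor_x (mat (Suc d) (Suc d) g)"
  have X: "?X $$ (i, j) = g (Suc i, Suc j)" if "i < d" "j < d" for i j
    using that by (simp add: mat_delete_def)
  have dim: "dim_row ?X = d" "dim_col ?X = d" by simp_all
  have tr: "trace ?X = (\<Sum>i<d. g (Suc i, Suc i))"
    unfolding trace_def dim by (intro sum.cong) (auto simp: X)
  have l1: "ones d \<bullet> (map_mat abs ?X *\<^sub>v ones d) = (\<Sum>i<d. \<Sum>j<d. \<bar>g (Suc i, Suc j)\<bar>)"
    using dim
    by (auto simp: scalar_prod_def ones_def atLeast0LessThan X simp del: mat_delete_dim intro!: sum.cong)
  show ?thesis
    unfolding sdp_feasible_def feasible_fun_def tr l1 by (auto simp: psd_mat_iff X)
qed

lemma sdp_feasible_iff: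
  "sdp_feasible d \<sigma> W \<longleftrightarrow> W \<in> carrier_mat (Suc d) (Suc d) \<and> feasible_fun d \<sigma> (($$) W)"
proof (cases "W \<in> carrier_mat (Suc d) (Suc d)")
  case True
  then have "mat (Suc d) (Suc d) (($$) W) = W" by (auto simp: mat_eq_iff)
  then show ?thesis using sdp_feasible_mat[of d \<sigma> "($$) W"] True by simp
qed (auto simp: sdp_feasible_def psd_def)

lemma feasible_fun_sdp_point:
  assumes feas: "feasible_fun d \<sigma> g" and "\<sigma> \<le> d"
    and "\<And>i. i < \<sigma> \<Longrightarrow> z i * z i = 1" "\<And>i. \<sigma> \<le> i \<Longrightarrow> z i = 0"
  shows "sdp_point d \<sigma> z (\<lambda>i. g (0, Suc i)) (\<lambda>i j. g (Suc i, Suc j))"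
proof
  fix \<alpha> :: real and x :: "nat \<Rightarrow> real"
  have sym: "g (Suc i, 0) = g (0, Suc i)" if "i < d" for i
    using feas that by (simp add: feasible_fun_def)
  \<comment> \<open>The test vector has \<alpha> at index 0 followed by \<open>x\<close>; its form
    splits into the corner, two borders that agree by symmetry, and the minor.\<close>
  have "0 \<le> (\<Sum>i<Suc d. \<Sum>j<Suc d. case_nat \<alpha> x i * g (i, j) * case_nat \<alpha> x j)"
    using feas unfolding feasible_fun_def by blast
  also have "\<dots> = \<alpha> * \<alpha> * g (0, 0) + (\<Sum>j<d. \<alpha> * g (0, Suc j) * x j)
      + ((\<Sum>i<d. x i * g (Suc i, 0) * \<alpha>) + (\<Sum>i<d. \<Sum>j<d. x i * g (Suc i, Suc j) * x j))"
    unfolding sum.lessThan_Suc_shift by (simp add: sum.distrib)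
  also have "(\<Sum>i<d. x i * g (Suc i, 0) * \<alpha>) = (\<Sum>j<d. \<alpha> * g (0, Suc j) * x j)"
    by (intro sum.cong) (auto simp: sym)
  also have "(\<Sum>j<d. \<alpha> * g (0, Suc j) * x j) = \<alpha> * (\<Sum>i<d. g (0, Suc i) * x i)"
    by (simp add: sum_distrib_left mult.assoc)
  finally show "0 \<le> \<alpha> * \<alpha> + 2 * \<alpha> * (\<Sum>i<d. g (0, Suc i) * x i)
      + (\<Sum>i<d. \<Sum>j<d. x i * g (Suc i, Suc j) * x j)"
    using feas by (simp add: feasible_fun_def)
qed (use assms in \<open>auto simp: feasible_fun_def\<close>)

lemma trace_gram_mult:
  assumes X: "X \<in> carrier_mat n m" and W: "W \<in> carrier_mat m m"
  shows "trace (transpose_mat X * X * W)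
      = (\<Sum>r<n. \<Sum>k<m. \<Sum>l<m. X $$ (r, k) * X $$ (r, l) * W $$ (l, k))"
proof -
  have "trace (transpose_mat X * (X * W))
      = (\<Sum>k<m. \<Sum>r<n. X $$ (r, k) * (\<Sum>l<m. X $$ (r, l) * W $$ (l, k)))"
    using X W unfolding trace_def
    by (auto simp: scalar_prod_def atLeast0LessThan intro!: sum.cong)
  also have "\<dots> = (\<Sum>r<n. \<Sum>k<m. \<Sum>l<m. X $$ (r, k) * X $$ (r, l) * W $$ (l, k))"
    by (subst sum.swap) (simp add: sum_distrib_left mult.assoc)
  finally show ?thesis using X W by (simp add: assoc_mult_mat[of _ m n _ m _ m])
qed

lemma sdp_objective_eq:
  assumes M: "M \<in> carrier_mat n d" and W: "W \<in> carrier_mat (Suc d) (Suc d)"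
    and sym: "\<And>i j. i < Suc d \<Longrightarrow> j < Suc d \<Longrightarrow> W $$ (i, j) = W $$ (j, i)"
  shows "sdp_objective M b W = (1 / real n) * (\<Sum>r<n. (b $ r)\<^sup>2 * W $$ (0, 0)
      - 2 * b $ r * (\<Sum>j<d. M $$ (r, j) * W $$ (0, Suc j))
      + (\<Sum>j<d. \<Sum>k<d. M $$ (r, j) * M $$ (r, k) * W $$ (Suc j, Suc k)))"
proof -
  let ?A = "data_mat M b"
  have A: "?A \<in> carrier_mat n (Suc d)" using M by (simp add: data_mat_def)
  have A0: "?A $$ (r, 0) = - b $ r" if "r < n" for r
    using that M by (simp add: data_mat_def)
  have A1: "?A $$ (r, Suc j) = M $$ (r, j)" if "r < n" "j < d" for r j
    using that M by (simp add: data_mat_def)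
  have "trace (transpose_mat ?A * ?A * W)
      = (\<Sum>r<n. \<Sum>k<Suc d. \<Sum>l<Suc d. ?A $$ (r, k) * ?A $$ (r, l) * W $$ (l, k))"
    by (rule trace_gram_mult[OF A W])
  also have "\<dots> = (\<Sum>r<n. (b $ r)\<^sup>2 * W $$ (0, 0)
      - 2 * b $ r * (\<Sum>j<d. M $$ (r, j) * W $$ (0, Suc j))
      + (\<Sum>j<d. \<Sum>k<d. M $$ (r, j) * M $$ (r, k) * W $$ (Suc j, Suc k)))"
  proof (intro sum.cong refl)
    fix r assume "r \<in> {..<n}"
    then have r: "r < n" by simp
    have *: "(\<Sum>k<d. ?A $$ (r, Suc k) * ?A $$ (r, 0) * W $$ (0, Suc k))
         = - b $ r * (\<Sum>j<d. M $$ (r, j) * W $$ (0, Suc j))"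
      by (simp add: A0[OF r] A1[OF r] sum_distrib_left mult.commute mult.left_commute flip: sum_negf)
    have "(\<Sum>l<d. ?A $$ (r, 0) * ?A $$ (r, Suc l) * W $$ (Suc l, 0))
         = (\<Sum>k<d. ?A $$ (r, Suc k) * ?A $$ (r, 0) * W $$ (0, Suc k))"
      by (intro sum.cong) (auto simp: sym[of 0])
    note ** = this[unfolded *]
    have ***: "(\<Sum>k<d. \<Sum>l<d. ?A $$ (r, Suc k) * ?A $$ (r, Suc l) * W $$ (Suc l, Suc k))
        = (\<Sum>j<d. \<Sum>k<d. M $$ (r, j) * M $$ (r, k) * W $$ (Suc j, Suc k))"
      using r by (intro sum.cong) (auto simp: A1 sym)
    show "(\<Sum>k<Suc d. \<Sum>l<Suc d. ?A $$ (r, k) * ?A $$ (r, l) * W $$ (l, k))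
      = (b $ r)\<^sup>2 * W $$ (0, 0) - 2 * b $ r * (\<Sum>j<d. M $$ (r, j) * W $$ (0, Suc j))
      + (\<Sum>j<d. \<Sum>k<d. M $$ (r, j) * M $$ (r, k) * W $$ (Suc j, Suc k))"
      unfolding sum.lessThan_Suc_shift sum.distrib
      unfolding * ** *** unfolding A0[OF r]
      by (simp add: power2_eq_square)
  qed
  finally show ?thesis using M by (simp add: sdp_objective_def)
qed

section \<open>The planted rank-one matrix and deterministic recovery\<close>

lemma lifted_index:
  assumes "z \<in> carrier_vec d"
  shows "lifted z \<in> carrier_mat (Suc d) (Suc d)" "lifted z $$ (0, 0) = 1"
    "j < d \<Longrightarrow> lifted z $$ (0, Suc j) = z $ j"
    "i < d \<Longrightarrow> lifted z $$ (Suc i, 0) = z $ i"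
    "i < d \<Longrightarrow> j < d \<Longrightarrow> lifted z $$ (Suc i, Suc j) = z $ i * z $ j"
  using assms by (auto simp: lifted_def)

lemma lifted_sym:
  assumes "z \<in> carrier_vec d" "i < Suc d" "j < Suc d"
  shows "lifted z $$ (i, j) = lifted z $$ (j, i)"
  using assms by (auto simp: lifted_def)

text \<open>Rank one makes the form a perfect square. Entries in {-1, 0, 1} satisfy
  \<open>\<bar>z $ i\<bar> = z $ i * z $ i\<close>, so the trace is \<sigma> and the entrywise norm
  constraint holds with equality.\<close>

lemma sdp_feasible_lifted:
  assumes z: "z \<in> carrier_vec d" and "\<sigma> \<le> d"
    and on: "\<And>i. i < \<sigma> \<Longrightarrow> z $ i * z $ i = 1"
    and off: "\<And>i. i < d \<Longrightarrow> \<sigma> \<le> i \<Longrightarrow> z $ i = 0"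
  shows "sdp_feasible d \<sigma> (lifted z)"
proof -
  note L = lifted_index[OF z]
  have split: "{..<d} = {..<\<sigma>} \<union> {\<sigma>..<d}" using \<open>\<sigma> \<le> d\<close> by auto
  have sq: "(\<Sum>i<d. z $ i * z $ i) = real \<sigma>"
    unfolding split by (subst sum.union_disjoint) (auto simp: on off)
  have "\<bar>z $ i\<bar> = z $ i * z $ i" if "i < d" for i
    using on[of i] off[of i] that
    by (cases "i < \<sigma>") (auto simp: abs_square_eq_1 power2_eq_square[symmetric])
  then have abs: "(\<Sum>i<d. \<bar>z $ i\<bar>) = real \<sigma>" using sq by simp
  have form: "(\<Sum>i<Suc d. \<Sum>j<Suc d. x i * lifted z $$ (i, j) * x j)
      = (\<Sum>i<Suc d. vCons 1 z $ i * x i)\<^sup>2" for x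
    using z unfolding power2_eq_square sum_product by (intro sum.cong) (auto simp: lifted_def)
  have "feasible_fun d \<sigma> (($$) (lifted z))"
    unfolding feasible_fun_def form
  proof (intro conjI allI impI)
    show "(\<Sum>i<d. lifted z $$ (Suc i, Suc i)) = real \<sigma>" by (simp add: L sq)
    show "(\<Sum>i<d. \<Sum>j<d. \<bar>lifted z $$ (Suc i, Suc j)\<bar>) \<le> (real \<sigma>)\<^sup>2"
      by (simp add: L abs_mult abs power2_eq_square flip: sum_product)
    show "lifted z $$ (Suc i, Suc i) \<le> 1" if "i < d" for i
      using that on[of i] off[of i] by (cases "i < \<sigma>") (simp_all add: L)
  qed (use z in \<open>auto simp: L lifted_def\<close>)
  then show ?thesis by (simp add: sdp_feasible_iff L)
qed

text \<open>Replaces the unique optimum by strict inequalities, the form used both for the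
  deterministic argument and for measurability. A feasible \<open>W\<close> that is not optimal is
  strictly beaten by some feasible \<open>W'\<close>, which the target beats at least
  weakly.\<close>

lemma sdp_recovers_iff:
  assumes M: "M \<in> carrier_mat n d" and z: "z \<in> carrier_vec d" "\<forall>i<d. z $ i \<in> {-1, 0, 1}"
    and feas: "sdp_feasible d \<sigma> (lifted z)"
  shows "sdp_recovers M b \<sigma> z \<longleftrightarrow> (\<forall>W. sdp_feasible d \<sigma> W \<longrightarrow> W \<noteq> lifted z \<longrightarrow>
     sdp_objective M b (lifted z) < sdp_objective M b W)"
proof -
  let ?o = "sdp_objective M b"
  have "{W. sdp_optimal M b \<sigma> W} = {lifted z} \<longleftrightarrow>
      (\<forall>W. sdp_feasible d \<sigma> W \<longrightarrow> W \<noteq> lifted z \<longrightarrow> ?o (lifted z) < ?o W)" (is "?L \<longleftrightarrow> ?R")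
  proof
    assume L: ?L
    show ?R
    proof (intro allI impI)
      fix W assume W: "sdp_feasible d \<sigma> W" "W \<noteq> lifted z"
      have opt: "sdp_optimal M b \<sigma> (lifted z)" and not: "\<not> sdp_optimal M b \<sigma> W" using L W by auto
      from not obtain W' where W': "sdp_feasible d \<sigma> W'" "?o W' < ?o W"
        using W M by (auto simp: sdp_optimal_def not_le)
      moreover have "?o (lifted z) \<le> ?o W'" using opt W' M by (simp add: sdp_optimal_def)
      ultimately show "?o (lifted z) < ?o W" by simp
    qed
  next
    assume R: ?R
    then have "?o (lifted z) \<le> ?o W" if "sdp_feasible d \<sigma> W" for W
      using that by (cases "W = lifted z") (auto simp: less_imp_le)
    then have "sdp_optimal M b \<sigma> (lifted z)" using feas M by (simp add: sdp_optimal_def)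
    moreover have "W = lifted z" if "sdp_optimal M b \<sigma> W" for W
    proof (rule ccontr)
      assume "W \<noteq> lifted z"
      moreover have "sdp_feasible d \<sigma> W" "?o W \<le> ?o (lifted z)"
        using that feas M by (simp_all add: sdp_optimal_def)
      ultimately show False using R by force
    qed
    ultimately show ?L by blast
  qed
  then show ?thesis using M z by (simp add: sdp_recovers_def)
qed

text \<open>The deterministic part. After substituting the model for the right-hand side, the
  objective at the target is the mean of the squared noise, and its excess at \<open>W\<close> is
  the quantity of \<open>objective_lower\<close>. The gap is nonzero by \<open>gap_zero\<close>, as
  \<open>W\<close> differs from the target.\<close>

lemma sdp_recoversI:
  assumes M: "M \<in> carrier_mat n d" and \<epsilon>: "\<epsilon> \<in> carrier_vec n"
    and z: "z \<in> carrier_vec d" and "\<sigma> \<le> d"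
    and on: "\<And>i. i < \<sigma> \<Longrightarrow> z $ i \<in> {-1, 1}"
    and off: "\<And>i. i < d \<Longrightarrow> \<sigma> \<le> i \<Longrightarrow> z $ i = 0"
    and G_off: "\<And>j k. j < d \<Longrightarrow> k < d \<Longrightarrow> j \<noteq> k \<Longrightarrow>
      \<bar>(\<Sum>r<n. M $$ (r, j) * M $$ (r, k)) / real n - m\<^sup>2\<bar> \<le> \<eta>"
    and G_diag: "\<And>j. j < d \<Longrightarrow> m\<^sup>2 + v - \<eta> \<le> (\<Sum>r<n. M $$ (r, j) * M $$ (r, j)) / real n"
    and g: "\<And>j. j < d \<Longrightarrow> \<bar>(\<Sum>r<n. M $$ (r, j) * \<epsilon> $ r) / real n\<bar> \<le> \<delta>"
    and small: "6 * real \<sigma> * \<eta> + 4 * \<delta> < 2 * v" and "0 \<le> \<eta>"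
  shows "sdp_recovers M (M *\<^sub>v z + \<epsilon>) \<sigma> z"
proof -
  define b where "b = M *\<^sub>v z + \<epsilon>"
  \<comment> \<open>The locale wants zeros at all indices from \<sigma> on, whereas
    \<open>z $ i\<close> is unspecified for \<open>i \<ge> d\<close>.\<close>
  define zf where "zf i = (if i < d then z $ i else 0)" for i
  have on': "z $ i * z $ i = 1" if "i < \<sigma>" for i using on[OF that] by auto
  have zf: "\<And>i. i < \<sigma> \<Longrightarrow> zf i * zf i = 1" "\<And>i. \<sigma> \<le> i \<Longrightarrow> zf i = 0"
    using on' off \<open>\<sigma> \<le> d\<close> by (auto simp: zf_def)
  note L = lifted_index[OF z]
  have feas: "sdp_feasible d \<sigma> (lifted z)"
    using z \<open>\<sigma> \<le> d\<close> on' off by (rule sdp_feasible_lifted)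
  have vals: "\<forall>i<d. z $ i \<in> {-1, 0, 1}" using on off by (metis insertCI insertE leI singletonD)
  have b: "b $ r = (\<Sum>j<d. M $$ (r, j) * z $ j) + \<epsilon> $ r" if "r < n" for r
    using that M \<epsilon> z by (auto simp: b_def scalar_prod_def atLeast0LessThan intro!: sum.cong)
  have "sdp_objective M b (lifted z) < sdp_objective M b W"
    if W: "sdp_feasible d \<sigma> W" "W \<noteq> lifted z" for W
  proof -
    have carrier: "W \<in> carrier_mat (Suc d) (Suc d)" and fW: "feasible_fun d \<sigma> (($$) W)"
      using W by (simp_all add: sdp_feasible_iff)
    interpret sdp_point d \<sigma> zf "\<lambda>i. W $$ (0, Suc i)" "\<lambda>i j. W $$ (Suc i, Suc j)"
      using feasible_fun_sdp_point[OF fW \<open>\<sigma> \<le> d\<close> zf] .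
    have symW: "W $$ (i, j) = W $$ (j, i)" if "i < Suc d" "j < Suc d" for i j
      using fW that by (simp add: feasible_fun_def)
    have gap: "gap \<noteq> 0"
    proof
      assume 0: "gap = 0"
      have "W $$ (i, j) = lifted z $$ (i, j)" if "i < Suc d" "j < Suc d" for i j
        using that gap_zero[OF 0] fW symW
        by (cases i; cases j) (auto simp: L zf_def feasible_fun_def)
      then show False using W carrier L(1) by (auto simp: mat_eq_iff)
    qed
    let ?G = "\<lambda>j k. (\<Sum>r<n. M $$ (r, j) * M $$ (r, k)) / real n"
    let ?g = "\<lambda>j. (\<Sum>r<n. M $$ (r, j) * \<epsilon> $ r) / real n"
    have row: "(b $ r)\<^sup>2 * W $$ (0, 0) - 2 * b $ r * (\<Sum>j<d. M $$ (r, j) * W $$ (0, Suc j))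
        + (\<Sum>j<d. \<Sum>k<d. M $$ (r, j) * M $$ (r, k) * W $$ (Suc j, Suc k))
        = (\<epsilon> $ r)\<^sup>2 + (\<Sum>j<d. \<Sum>k<d. M $$ (r, j) * M $$ (r, k) * H j k)
          - 2 * (\<Sum>j<d. M $$ (r, j) * \<epsilon> $ r * (W $$ (0, Suc j) - zf j))" if r: "r < n" for r
    proof -
      \<comment> \<open>With \<open>e\<close> the noise in row \<open>r\<close>, the identity is
        \<open>(p + e)^2 - 2 (p + e) q + Q = e^2 + (Q - 2 p q + p^2) - 2 e (q - p)\<close>.\<close>
      define p where "p = (\<Sum>j<d. M $$ (r, j) * zf j)"
      define q where "q = (\<Sum>j<d. M $$ (r, j) * W $$ (0, Suc j))"
      define Q where "Q = (\<Sum>j<d. \<Sum>k<d. M $$ (r, j) * M $$ (r, k) * W $$ (Suc j, Suc k))"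
      have 1: "b $ r = p + \<epsilon> $ r" by (simp add: b[OF r] p_def zf_def)
      have "(\<Sum>j<d. \<Sum>k<d. M $$ (r, j) * M $$ (r, k) * H j k)
          = (\<Sum>j<d. \<Sum>k<d. M $$ (r, j) * H j k * M $$ (r, k))"
        by (simp add: mult_ac)
      also have "\<dots> = Q - q * p - p * q + p * p"
        unfolding H_form p_def q_def Q_def by (simp add: mult_ac)
      finally have 2: "(\<Sum>j<d. \<Sum>k<d. M $$ (r, j) * M $$ (r, k) * H j k) = Q - 2 * p * q + p * p"
        by simp
      have 3: "(\<Sum>j<d. M $$ (r, j) * \<epsilon> $ r * (W $$ (0, Suc j) - zf j)) = \<epsilon> $ r * (q - p)"
        unfolding p_def q_def sum_subtractf[symmetric] sum_distrib_left
        by (intro sum.cong) (simp_all add: algebra_simps)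
      have 4: "W $$ (0, 0) = 1" using fW by (simp add: feasible_fun_def)
      show ?thesis unfolding 1 2 3 4 q_def[symmetric] Q_def[symmetric]
        by (simp add: power2_eq_square algebra_simps)
    qed
    have "0 < (\<Sum>j<d. \<Sum>k<d. ?G j k * H j k) - 2 * (\<Sum>j<d. ?g j * (W $$ (0, Suc j) - zf j))"
      using G_off G_diag g small \<open>0 \<le> \<eta>\<close> gap by (rule objective_lower)
    also have "(\<Sum>j<d. \<Sum>k<d. ?G j k * H j k)
        = (\<Sum>r<n. \<Sum>j<d. \<Sum>k<d. M $$ (r, j) * M $$ (r, k) * H j k) / real n"
    proof -
      have "(\<Sum>r<n. \<Sum>j<d. \<Sum>k<d. M $$ (r, j) * M $$ (r, k) * H j k)
          = (\<Sum>j<d. \<Sum>r<n. \<Sum>k<d. M $$ (r, j) * M $$ (r, k) * H j k)" by (rule sum.swap)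
      also have "\<dots> = (\<Sum>j<d. \<Sum>k<d. \<Sum>r<n. M $$ (r, j) * M $$ (r, k) * H j k)"
        by (intro sum.cong refl sum.swap)
      finally show ?thesis by (simp add: sum_divide_distrib sum_distrib_right)
    qed
    also have "(\<Sum>j<d. ?g j * (W $$ (0, Suc j) - zf j))
        = (\<Sum>r<n. \<Sum>j<d. M $$ (r, j) * \<epsilon> $ r * (W $$ (0, Suc j) - zf j)) / real n"
    proof -
      have "(\<Sum>r<n. \<Sum>j<d. M $$ (r, j) * \<epsilon> $ r * (W $$ (0, Suc j) - zf j))
          = (\<Sum>j<d. \<Sum>r<n. M $$ (r, j) * \<epsilon> $ r * (W $$ (0, Suc j) - zf j))" by (rule sum.swap)
      then show ?thesis by (simp add: sum_divide_distrib sum_distrib_right)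
    qed
    finally have diff: "(\<Sum>r<n. (\<epsilon> $ r)\<^sup>2) / real n < (\<Sum>r<n. (\<epsilon> $ r)\<^sup>2
          + (\<Sum>j<d. \<Sum>k<d. M $$ (r, j) * M $$ (r, k) * H j k)
          - 2 * (\<Sum>j<d. M $$ (r, j) * \<epsilon> $ r * (W $$ (0, Suc j) - zf j))) / real n"
      by (simp add: sum.distrib sum_subtractf add_divide_distrib diff_divide_distrib
          sum_distrib_left[symmetric] del: sum_divide_distrib)
    have objW: "sdp_objective M b W = (\<Sum>r<n. (\<epsilon> $ r)\<^sup>2
          + (\<Sum>j<d. \<Sum>k<d. M $$ (r, j) * M $$ (r, k) * H j k)
          - 2 * (\<Sum>j<d. M $$ (r, j) * \<epsilon> $ r * (W $$ (0, Suc j) - zf j))) / real n"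
      by (subst sdp_objective_eq[OF M carrier symW]) (simp_all add: row)
    have "sdp_objective M b (lifted z) = (\<Sum>r<n. (\<epsilon> $ r)\<^sup>2) / real n"
    proof -
      have row0: "(b $ r)\<^sup>2 * lifted z $$ (0, 0)
          - 2 * b $ r * (\<Sum>j<d. M $$ (r, j) * lifted z $$ (0, Suc j))
          + (\<Sum>j<d. \<Sum>k<d. M $$ (r, j) * M $$ (r, k) * lifted z $$ (Suc j, Suc k)) = (\<epsilon> $ r)\<^sup>2"
        if r: "r < n" for r
      proof -
        define p where "p = (\<Sum>j<d. M $$ (r, j) * z $ j)"
        have 1: "(\<Sum>j<d. \<Sum>k<d. M $$ (r, j) * M $$ (r, k) * lifted z $$ (Suc j, Suc k)) = p * p"
          unfolding p_def sum_product by (intro sum.cong) (simp_all add: L)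
        have 2: "(\<Sum>j<d. M $$ (r, j) * lifted z $$ (0, Suc j)) = p"
          unfolding p_def by (intro sum.cong) (simp_all add: L)
        have 3: "b $ r = p + \<epsilon> $ r" using b[OF r] by (simp add: p_def)
        show ?thesis unfolding 1 2 3 L(2) by (simp add: power2_eq_square algebra_simps)
      qed
      show ?thesis
        by (subst sdp_objective_eq[OF M L(1)]) (use lifted_sym[OF z] in \<open>simp_all add: row0\<close>)
    qed
    then show ?thesis using diff objW by simp
  qed
  then show ?thesis
    using sdp_recovers_iff[OF M z vals feas] unfolding b_def by blast
qed

section \<open>Measurability of the recovery event\<close>

text \<open>A continuous positive function on a compact set is bounded below by some
  \<open>1 / (k + 1)\<close>. Such a closed bound holds on all of \<open>S\<close> once it holds on
  a countable dense subset, so the uncountable quantifier becomes countable.\<close>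

lemma sets_compact_all_pos:
  fixes f :: "'a \<Rightarrow> 'b::{metric_space, second_countable_topology} \<Rightarrow> real"
  assumes S: "compact S"
    and cont: "\<And>\<omega>. \<omega> \<in> space M \<Longrightarrow> continuous_on S (f \<omega>)"
    and meas: "\<And>g. g \<in> S \<Longrightarrow> (\<lambda>\<omega>. f \<omega> g) \<in> borel_measurable M"
  shows "{\<omega> \<in> space M. \<forall>g\<in>S. 0 < f \<omega> g} \<in> sets M"
proof -
  obtain T where T: "countable T" "T \<subseteq> S" "S \<subseteq> closure T" by (rule separable[of S])
  have closure: "closure T = S"
    using T S by (meson closure_minimal compact_imp_closed subset_antisym)
  have eq: "(\<forall>g\<in>S. 0 < f \<omega> g) \<longleftrightarrow> (\<exists>k. \<forall>g\<in>T. 1 / real (Suc k) \<le> f \<omega> g)"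
    if \<omega>: "\<omega> \<in> space M" for \<omega>
  proof
    assume pos: "\<forall>g\<in>S. 0 < f \<omega> g"
    show "\<exists>k. \<forall>g\<in>T. 1 / real (Suc k) \<le> f \<omega> g"
    proof (cases "S = {}")
      case False
      then obtain g0 where g0: "g0 \<in> S" "\<And>g. g \<in> S \<Longrightarrow> f \<omega> g0 \<le> f \<omega> g"
        using continuous_attains_inf[OF S _ cont[OF \<omega>]] by blast
      obtain k where "1 / real (Suc k) < f \<omega> g0"
        using pos g0 nat_approx_posE by blast
      then show ?thesis using g0 T by (intro exI[of _ k]) force
    qed (use T in auto)
  next
    assume "\<exists>k. \<forall>g\<in>T. 1 / real (Suc k) \<le> f \<omega> g"
    then obtain k where k: "\<And>g. g \<in> T \<Longrightarrow> 1 / real (Suc k) \<le> f \<omega> g" by blast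
    have "1 / real (Suc k) \<le> f \<omega> g" if "g \<in> S" for g
      using continuous_ge_on_closure[of T "f \<omega>" g "1 / real (Suc k)"] cont[OF \<omega>] that k
      by (simp add: closure)
    then show "\<forall>g\<in>S. 0 < f \<omega> g" by (meson less_le_trans of_nat_0_less_iff zero_less_Suc zero_less_divide_1_iff)
  qed
  then have "{\<omega> \<in> space M. \<forall>g\<in>S. 0 < f \<omega> g} = {\<omega> \<in> space M. \<exists>k. \<forall>g\<in>T. 1 / real (Suc k) \<le> f \<omega> g}"
    by blast
  also have "\<dots> \<in> sets M"
  proof (intro sets.sets_Collect_countable_Ex sets.sets_Collect_countable_All' T(1))
    fix k g assume "g \<in> T"
    then have "(\<lambda>\<omega>. f \<omega> g) \<in> borel_measurable M" using T meas by blast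
    then show "{\<omega> \<in> space M. 1 / real (Suc k) \<le> f \<omega> g} \<in> sets M" by measurable
  qed
  finally show ?thesis .
qed

lemma feasible_fun_entry_bound:
  assumes feas: "feasible_fun d \<sigma> g" and "i < Suc d" "j < Suc d"
  shows "\<bar>g (i, j)\<bar> \<le> 1"
proof -
  have diag: "g (k, k) \<le> 1" if "k < Suc d" for k
    using feas that by (cases k) (auto simp: feasible_fun_def)
  have "\<bar>g (i, j)\<bar> \<le> (g (i, i) + g (j, j)) / 2"
    by (rule psd_form_entry_bound[where H = "\<lambda>i j. g (i, j)"]) (use assms in \<open>auto simp: feasible_fun_def\<close>)
  then show ?thesis using diag[OF assms(2)] diag[OF assms(3)] by simp
qed

text \<open>Fixing the value 0 outside the index square makes functions correspond one to one to
  matrices and bounds every coordinate.\<close>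

definition feasible_funs :: "nat \<Rightarrow> nat \<Rightarrow> (nat \<times> nat \<Rightarrow> real) set" where
  "feasible_funs d \<sigma> = {g. feasible_fun d \<sigma> g \<and> (\<forall>p. p \<notin> {..<Suc d} \<times> {..<Suc d} \<longrightarrow> g p = 0)}"

text \<open>A closed subset of the Tychonoff cube with sides \<open>{-1..1}\<close>; each constraint
  is a closed condition on finitely many coordinates.\<close>

lemma compact_feasible_funs: "compact (feasible_funs d \<sigma>)"
proof -
  have "compactin (product_topology (\<lambda>_. euclidean) UNIV) (PiE UNIV (\<lambda>_::nat \<times> nat. {-1..1::real}))"
    by (subst compactin_PiE) simp
  then have box: "compact (PiE UNIV (\<lambda>_::nat \<times> nat. {-1..1::real}))"
    by (simp add: euclidean_product_topology)
  have "feasible_funs d \<sigma> \<subseteq> PiE UNIV (\<lambda>_. {-1..1})"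
  proof
    fix g assume g: "g \<in> feasible_funs d \<sigma>"
    have "\<bar>g (i, j)\<bar> \<le> 1" for i j
      using g feasible_fun_entry_bound[of d \<sigma> g i j]
      by (cases "i < Suc d \<and> j < Suc d") (auto simp: feasible_funs_def)
    then show "g \<in> PiE UNIV (\<lambda>_. {-1..1})" by (auto simp: abs_le_iff minus_le_iff)
  qed
  moreover have "closed (feasible_funs d \<sigma>)"
    unfolding feasible_funs_def feasible_fun_def
    by (intro closed_Collect_conj closed_Collect_all closed_Collect_imp open_Collect_const
        closed_Collect_le closed_Collect_eq continuous_intros continuous_on_product_coordinates)
  ultimately show ?thesis using box by (metis compact_Int_closed inf.absorb_iff2)
qed

lemma measurable_sample_entries:
  assumes "sets D = sets borel" "sets E = sets borel"
  shows "i < n \<Longrightarrow> j < d \<Longrightarrow> (\<lambda>\<omega>. fst \<omega> (i, j)) \<in> borel_measurable (sample_measure n d D E)"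
    and "i < n \<Longrightarrow> (\<lambda>\<omega>. snd \<omega> i) \<in> borel_measurable (sample_measure n d D E)"
proof -
  show "(\<lambda>\<omega>. fst \<omega> (i, j)) \<in> borel_measurable (sample_measure n d D E)" if "i < n" "j < d"
    unfolding sample_measure_def using that
    by (intro measurable_compose[OF measurable_fst])
      (simp add: measurable_component_singleton flip: measurable_cong_sets[OF refl assms(1)])
  show "(\<lambda>\<omega>. snd \<omega> i) \<in> borel_measurable (sample_measure n d D E)" if "i < n"
    unfolding sample_measure_def using that
    by (intro measurable_compose[OF measurable_snd])
      (simp add: measurable_component_singleton flip: measurable_cong_sets[OF refl assms(2)])
qed

text \<open>
  Needed because \<^const>\<open>measure\<close> is 0 on non-measurable sets. The feasible matrices other than the
  target are exhausted by the compact sets \<open>S k\<close> of those at distance at least \<open>1 / (k + 1)\<close> from it.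
\<close>

lemma sets_recovery_event:
  assumes D: "sets D = sets borel" and E: "sets E = sets borel"
    and z: "z \<in> carrier_vec d" and "\<sigma> \<le> d"
    and on: "\<And>i. i < \<sigma> \<Longrightarrow> z $ i \<in> {-1, 1}"
    and off: "\<And>i. i < d \<Longrightarrow> \<sigma> \<le> i \<Longrightarrow> z $ i = 0"
  shows "recovery_event n d \<sigma> D E z \<in> sets (sample_measure n d D E)"
proof -
  let ?P = "sample_measure n d D E"
  define M :: "(nat \<times> nat \<Rightarrow> real) \<times> (nat \<Rightarrow> real) \<Rightarrow> real mat" where "M \<omega> = mat n d (fst \<omega>)" for \<omega>
  define b where "b \<omega> = M \<omega> *\<^sub>v z + vec n (snd \<omega>)" for \<omega>
  \<comment> \<open>\<open>ext\<close> and \<open>?m\<close> are mutually inverse between feasible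
    matrices and \<open>feasible_funs\<close>, which moves the quantifier over matrices to a compact
    set of functions.\<close>
  define ext :: "real mat \<Rightarrow> nat \<times> nat \<Rightarrow> real"
    where "ext W p = (if p \<in> {..<Suc d} \<times> {..<Suc d} then W $$ p else 0)" for W p
  let ?m = "mat (Suc d) (Suc d)"
  have on': "z $ i * z $ i = 1" if "i < \<sigma>" for i using on[OF that] by auto
  have vals: "\<forall>i<d. z $ i \<in> {-1, 0, 1}" using on off by (metis insertCI insertE leI singletonD)
  have feas: "sdp_feasible d \<sigma> (lifted z)"
    using z \<open>\<sigma> \<le> d\<close> on' off by (rule sdp_feasible_lifted)
  have mat_ext: "?m (ext W) = W" if "W \<in> carrier_mat (Suc d) (Suc d)" for W
    using that by (auto simp: ext_def mat_eq_iff)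
  have ext_mat: "ext (?m g) = g" if "g \<in> feasible_funs d \<sigma>" for g
    using that by (fastforce simp: ext_def feasible_funs_def)
  have ext_feas: "ext W \<in> feasible_funs d \<sigma>" if "sdp_feasible d \<sigma> W" for W
  proof -
    have "sdp_feasible d \<sigma> (?m (ext W))" using that mat_ext by (simp add: sdp_feasible_iff)
    then show ?thesis by (auto simp: feasible_funs_def sdp_feasible_mat ext_def)
  qed
  have mat_feas: "sdp_feasible d \<sigma> (?m g)" if "g \<in> feasible_funs d \<sigma>" for g
    using that by (simp add: feasible_funs_def sdp_feasible_mat)
  define g0 where "g0 = ext (lifted z)"
  have g0: "g0 \<in> feasible_funs d \<sigma>" unfolding g0_def by (rule ext_feas[OF feas])
  have mat_g0: "?m g0 = lifted z" unfolding g0_def by (rule mat_ext[OF lifted_index(1)[OF z]])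
  define f where "f \<omega> g = sdp_objective (M \<omega>) (b \<omega>) (?m g) - sdp_objective (M \<omega>) (b \<omega>) (lifted z)" for \<omega> g
  define S where "S k = feasible_funs d \<sigma> \<inter> {g. 1 / real (Suc k) \<le> dist g g0}" for k
  \<comment> \<open>One formula serves twice: for fixed \<open>g\<close> it is a polynomial in the
    sample, hence measurable; for fixed \<omega> it is linear in the entries of \<open>g\<close>,
    hence continuous.\<close>
  have obj: "sdp_objective (M \<omega>) (b \<omega>) (?m g) = (1 / real n) * (\<Sum>r<n.
      ((\<Sum>j<d. fst \<omega> (r, j) * z $ j) + snd \<omega> r)\<^sup>2 * g (0, 0)
      - 2 * ((\<Sum>j<d. fst \<omega> (r, j) * z $ j) + snd \<omega> r) * (\<Sum>j<d. fst \<omega> (r, j) * g (0, Suc j))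
      + (\<Sum>j<d. \<Sum>k<d. fst \<omega> (r, j) * fst \<omega> (r, k) * g (Suc j, Suc k)))"
    if "g \<in> feasible_funs d \<sigma>" for g \<omega>
  proof -
    have "b \<omega> $ r = (\<Sum>j<d. fst \<omega> (r, j) * z $ j) + snd \<omega> r" if "r < n" for r
      using that z by (auto simp: b_def M_def scalar_prod_def atLeast0LessThan intro!: sum.cong)
    moreover have "sdp_objective (M \<omega>) (b \<omega>) (?m g) = (1 / real n) * (\<Sum>r<n. (b \<omega> $ r)\<^sup>2 * ?m g $$ (0, 0)
      - 2 * b \<omega> $ r * (\<Sum>j<d. M \<omega> $$ (r, j) * ?m g $$ (0, Suc j))
      + (\<Sum>j<d. \<Sum>k<d. M \<omega> $$ (r, j) * M \<omega> $$ (r, k) * ?m g $$ (Suc j, Suc k)))"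
      using that by (intro sdp_objective_eq) (auto simp: M_def feasible_funs_def feasible_fun_def)
    ultimately show ?thesis by (simp add: M_def)
  qed
  have f_eq: "f \<omega> g = sdp_objective (M \<omega>) (b \<omega>) (?m g) - sdp_objective (M \<omega>) (b \<omega>) (?m g0)" for \<omega> g
    by (simp add: f_def mat_g0)
  have step: "{\<omega> \<in> space ?P. \<forall>g\<in>S k. 0 < f \<omega> g} \<in> sets ?P" for k
  proof (rule sets_compact_all_pos)
    show "compact (S k)" unfolding S_def
      by (intro compact_Int_closed compact_feasible_funs closed_Collect_le continuous_intros)
    show "continuous_on (S k) (f \<omega>)" for \<omega>
    proof (rule continuous_on_subset[of "feasible_funs d \<sigma>"])
      show "continuous_on (feasible_funs d \<sigma>) (f \<omega>)"
      proof (subst continuous_on_cong[OF refl])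
        fix g assume "g \<in> feasible_funs d \<sigma>"
        then show "f \<omega> g = (1 / real n) * (\<Sum>r<n.
            ((\<Sum>j<d. fst \<omega> (r, j) * z $ j) + snd \<omega> r)\<^sup>2 * g (0, 0)
            - 2 * ((\<Sum>j<d. fst \<omega> (r, j) * z $ j) + snd \<omega> r) * (\<Sum>j<d. fst \<omega> (r, j) * g (0, Suc j))
            + (\<Sum>j<d. \<Sum>k<d. fst \<omega> (r, j) * fst \<omega> (r, k) * g (Suc j, Suc k)))
            - sdp_objective (M \<omega>) (b \<omega>) (?m g0)"
          unfolding f_eq by (subst obj) simp_all
      qed (intro continuous_intros continuous_on_subset[OF continuous_on_product_coordinates subset_UNIV])
    qed (auto simp: S_def)
    fix g assume "g \<in> S k"
    then have g: "g \<in> feasible_funs d \<sigma>" by (simp add: S_def)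
    show "(\<lambda>\<omega>. f \<omega> g) \<in> borel_measurable ?P"
      unfolding f_eq obj[OF g] obj[OF g0]
      by (intro borel_measurable_diff borel_measurable_times borel_measurable_const borel_measurable_sum
          borel_measurable_add borel_measurable_power measurable_sample_entries D E) auto
  qed
  have "\<omega> \<in> recovery_event n d \<sigma> D E z \<longleftrightarrow> \<omega> \<in> space ?P \<and> (\<forall>k. \<forall>g\<in>S k. 0 < f \<omega> g)" for \<omega>
  proof -
    have "\<omega> \<in> recovery_event n d \<sigma> D E z \<longleftrightarrow> \<omega> \<in> space ?P \<and> sdp_recovers (M \<omega>) (b \<omega>) \<sigma> z"
      by (cases \<omega>) (simp add: recovery_event_def Let_def M_def b_def)
    also have "sdp_recovers (M \<omega>) (b \<omega>) \<sigma> z \<longleftrightarrow> (\<forall>W. sdp_feasible d \<sigma> W \<longrightarrow> W \<noteq> lifted z \<longrightarrow>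
        sdp_objective (M \<omega>) (b \<omega>) (lifted z) < sdp_objective (M \<omega>) (b \<omega>) W)"
      by (rule sdp_recovers_iff[OF _ z vals feas, of _ n]) (simp add: M_def)
    also have "\<dots> \<longleftrightarrow> (\<forall>g\<in>feasible_funs d \<sigma> - {g0}. 0 < f \<omega> g)"
    proof (intro iffI allI ballI impI)
      fix g assume *: "\<forall>W. sdp_feasible d \<sigma> W \<longrightarrow> W \<noteq> lifted z \<longrightarrow>
        sdp_objective (M \<omega>) (b \<omega>) (lifted z) < sdp_objective (M \<omega>) (b \<omega>) W"
        and g: "g \<in> feasible_funs d \<sigma> - {g0}"
      then have "?m g \<noteq> lifted z" using ext_mat g0_def by force
      then show "0 < f \<omega> g" using * mat_feas g by (simp add: f_def)
    next
      fix W assume *: "\<forall>g\<in>feasible_funs d \<sigma> - {g0}. 0 < f \<omega> g"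
        and W: "sdp_feasible d \<sigma> W" "W \<noteq> lifted z"
      have "?m (ext W) = W" using W by (simp add: mat_ext sdp_feasible_iff)
      moreover from this have "ext W \<noteq> g0" using W mat_g0 by auto
      ultimately show "sdp_objective (M \<omega>) (b \<omega>) (lifted z) < sdp_objective (M \<omega>) (b \<omega>) W"
        using * ext_feas[OF W(1)] by (auto simp: f_def dest: bspec[of _ _ "ext W"])
    qed
    also have "feasible_funs d \<sigma> - {g0} = (\<Union>k. S k)"
    proof (intro Set.set_eqI iffI)
      fix g assume g: "g \<in> feasible_funs d \<sigma> - {g0}"
      then obtain k where "1 / real (Suc k) < dist g g0" using nat_approx_posE[of "dist g g0"] by auto
      then show "g \<in> (\<Union>k. S k)" using g by (auto simp: S_def intro!: exI[of _ k])
    qed (auto simp: S_def)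
    finally show ?thesis by auto
  qed
  then have "recovery_event n d \<sigma> D E z = {\<omega> \<in> space ?P. \<forall>k. \<forall>g\<in>S k. 0 < f \<omega> g}" by auto
  also have "\<dots> \<in> sets ?P" by (intro sets.sets_Collect_countable_All step)
  finally show ?thesis .
qed

section \<open>Moment generating functions\<close>

text \<open>Exponential moments are kept as \<open>ennreal\<close> integrals, so that product and
  Fubini steps ask only for measurability.\<close>

lemma subgaussian_law_mgf:
  assumes "subgaussian_law D L"
  shows "(\<integral>\<^sup>+x. ennreal (exp (t * (x - law_mean D))) \<partial>D) \<le> ennreal (exp (t\<^sup>2 * L\<^sup>2 / 2))"
  using assms unfolding subgaussian_law_def subgaussian_def law_mean_def
  by (subst nn_integral_eq_integral) auto

lemma power_le_fact_exp:
  assumes "0 \<le> (x::real)"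
  shows "x ^ n \<le> fact n * exp x"
proof -
  have "(\<Sum>k\<in>{n}. x ^ k /\<^sub>R fact k) \<le> (\<Sum>k. x ^ k /\<^sub>R fact k)"
    using assms by (intro sum_le_suminf summable_exp_generic) (auto simp: scaleR_conv_of_real)
  then show ?thesis by (simp add: exp_def field_simps)
qed

lemma even_power_le_exp_sum:
  "(t * x) ^ (2 * k) \<le> fact (2 * k) * (exp (t * x) + exp (- (t * x :: real)))"
proof -
  have "(t * x) ^ (2 * k) = \<bar>t * x\<bar> ^ (2 * k)" by (simp add: power_even_abs)
  also have "\<dots> \<le> fact (2 * k) * exp \<bar>t * x\<bar>" by (intro power_le_fact_exp) simp
  also have "exp \<bar>t * x\<bar> \<le> exp (t * x) + exp (- (t * x))"
    by (cases "t * x \<ge> 0") (auto simp: abs_if)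
  finally show ?thesis by simp
qed

text \<open>Each of the \<open>k\<close> factors of \<open>fact (2 * k)\<close> beyond
  \<open>fact k\<close> is at most \<open>2 * k\<close>.\<close>

lemma fact_double_le: "fact (2 * k) \<le> (2 * real k) ^ k * fact k"
proof -
  have "fact (2 * k) = fact k * \<Prod>{Suc k..2 * k}"
    by (rule fact_eq_fact_times) simp
  also have "\<Prod>{Suc k..2 * k} \<le> (\<Prod>i=Suc k..2 * k. 2 * k)"
    by (intro prod_mono) auto
  finally have "fact (2 * k) \<le> (2 * k) ^ k * fact k" by (simp add: mult.commute)
  then have "real (fact (2 * k)) \<le> real ((2 * k) ^ k * fact k)" by (rule of_nat_mono)
  then show ?thesis by simp
qed

text \<open>An even power is one term of the exponential series at \<open>\<bar>t * x\<bar>\<close>,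
  which is dominated by the exponentials at both signs. The scale \<open>t\<close> stays free for
  later optimization.\<close>

lemma subgaussian_even_moment:
  assumes D: "subgaussian_law D 1"
  shows "(\<integral>\<^sup>+x. ennreal ((t * (x - law_mean D)) ^ (2 * k)) \<partial>D) \<le> ennreal (2 * fact (2 * k) * exp (t\<^sup>2 / 2))"
proof -
  have [measurable_cong]: "sets D = sets borel" using D by (simp add: subgaussian_law_def)
  have "(\<integral>\<^sup>+x. ennreal ((t * (x - law_mean D)) ^ (2 * k)) \<partial>D)
      \<le> (\<integral>\<^sup>+x. ennreal (fact (2 * k)) * (ennreal (exp (t * (x - law_mean D)))
          + ennreal (exp ((-t) * (x - law_mean D)))) \<partial>D)"
  proof (intro nn_integral_mono)
    fix x
    have "ennreal ((t * (x - law_mean D)) ^ (2 * k))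
        \<le> ennreal (fact (2 * k) * (exp (t * (x - law_mean D)) + exp (- (t * (x - law_mean D)))))"
      by (intro ennreal_leI even_power_le_exp_sum)
    then show "ennreal ((t * (x - law_mean D)) ^ (2 * k)) \<le> ennreal (fact (2 * k)) *
        (ennreal (exp (t * (x - law_mean D))) + ennreal (exp ((-t) * (x - law_mean D))))"
      by (simp add: ennreal_mult')
  qed
  also have "\<dots> = ennreal (fact (2 * k)) * ((\<integral>\<^sup>+x. ennreal (exp (t * (x - law_mean D))) \<partial>D)
      + (\<integral>\<^sup>+x. ennreal (exp ((-t) * (x - law_mean D))) \<partial>D))"
    by (subst nn_integral_cmult, measurable) (subst nn_integral_add, auto)
  also have "\<dots> \<le> ennreal (fact (2 * k)) * (ennreal (exp (t\<^sup>2 / 2)) + ennreal (exp (t\<^sup>2 / 2)))"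
    using subgaussian_law_mgf[OF D, of t] subgaussian_law_mgf[OF D, of "-t"]
    by (intro mult_left_mono add_mono) simp_all
  also have "\<dots> = ennreal (2 * fact (2 * k) * exp (t\<^sup>2 / 2))"
    by (simp flip: ennreal_plus ennreal_mult)
  finally show ?thesis .
qed

text \<open>The \<open>2k\<close>-th moment is estimated through the moment generating function at \<open>t = sqrt (2 * k)\<close>.\<close>

lemma subgaussian_square_power:
  assumes D: "subgaussian_law D 1" and "0 \<le> \<theta>" "0 < k"
  shows "(\<integral>\<^sup>+x. ennreal ((\<theta> * (x - law_mean D)\<^sup>2) ^ k / fact k) \<partial>D) \<le> ennreal (2 * (3 * \<theta>) ^ k)"
proof -
  have [measurable_cong]: "sets D = sets borel" using D by (simp add: subgaussian_law_def)
  define t where "t = sqrt (2 * real k)"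
  have t2: "t\<^sup>2 = 2 * real k" and tk: "t ^ (2 * k) = (2 * real k) ^ k"     using \<open>0 < k\<close> by (simp_all add: t_def power_mult)
  define c where "c = \<theta> ^ k / (fact k * (2 * real k) ^ k)"
  have c: "0 \<le> c" using \<open>0 \<le> \<theta>\<close> by (simp add: c_def)
  have eq: "(\<theta> * y\<^sup>2) ^ k / fact k = c * (t * y) ^ (2 * k)" for y :: real
  proof -
    have "c * (t * y) ^ (2 * k) = c * ((2 * real k) ^ k * (y\<^sup>2) ^ k)"
      by (simp only: power_mult_distrib[of t y] tk power_mult[of y])
    also have "\<dots> = (\<theta> * y\<^sup>2) ^ k / fact k"
      using \<open>0 < k\<close> unfolding power_mult_distrib[of \<theta>] c_def by (simp add: power_mult_distrib[of 2])
    finally show ?thesis by simp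
  qed
  have "(\<integral>\<^sup>+x. ennreal ((\<theta> * (x - law_mean D)\<^sup>2) ^ k / fact k) \<partial>D)
      = ennreal c * (\<integral>\<^sup>+x. ennreal ((t * (x - law_mean D)) ^ (2 * k)) \<partial>D)"
    unfolding eq using c by (subst nn_integral_cmult[symmetric]) (auto simp: ennreal_mult' )
  also have "\<dots> \<le> ennreal c * ennreal (2 * fact (2 * k) * exp (t\<^sup>2 / 2))"
    by (intro mult_left_mono subgaussian_even_moment[OF D]) simp
  \<comment> \<open>With \<open>t^2 = 2 k\<close> the factor \<open>exp (t^2 / 2)\<close> is the
    \<open>k\<close>-th power of e, and e < 3 gives the 3 in the conclusion.\<close>
  also have "\<dots> = ennreal (c * (2 * fact (2 * k) * exp 1 ^ k))"
    using c by (simp add: ennreal_mult' t2 flip: exp_of_nat_mult)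
  also have "\<dots> \<le> ennreal (c * (2 * ((2 * real k) ^ k * fact k) * 3 ^ k))"
    using fact_double_le[of k] exp_le c
    by (intro ennreal_leI mult_left_mono mult_mono power_mono) auto
  also have "c * (2 * ((2 * real k) ^ k * fact k) * 3 ^ k) = 2 * (3 * \<theta>) ^ k"
    using \<open>0 < k\<close> by (simp add: c_def power_mult_distrib)
  finally show ?thesis .
qed

text \<open>Integrating the exponential series termwise leaves 1 plus twice a geometric series in
  \<open>u = 3 * \<theta>\<close>, that is \<open>2 / (1 - u) - 1\<close>. The bound on \<theta>
  says \<open>u \<le> 1 / 2\<close>, where this is at most \<open>1 + 4 * u\<close>.\<close>

lemma subgaussian_exp_square:
  assumes D: "subgaussian_law D 1" and "0 \<le> \<theta>" "\<theta> \<le> 1 / 6"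
  shows "(\<integral>\<^sup>+x. ennreal (exp (\<theta> * (x - law_mean D)\<^sup>2)) \<partial>D) \<le> ennreal (exp (12 * \<theta>))"
proof -
  have [measurable_cong]: "sets D = sets borel" using D by (simp add: subgaussian_law_def)
  interpret prob_space D using D by (simp add: subgaussian_law_def)
  define u where "u = 3 * \<theta>"
  have u: "0 \<le> u" "u \<le> 1 / 2" using assms by (auto simp: u_def)
  let ?q = "\<lambda>x. \<theta> * (x - law_mean D)\<^sup>2"
  have series: "ennreal (exp (?q x)) = (\<Sum>k. ennreal (?q x ^ k / fact k))" for x
  proof -
    have "(\<lambda>k. ?q x ^ k / fact k) sums exp (?q x)"
      using exp_converges[of "?q x"] by (simp add: divide_inverse mult.commute)
    then show ?thesis using \<open>0 \<le> \<theta>\<close> by (intro suminf_ennreal_eq[symmetric]) auto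
  qed
  have "(\<integral>\<^sup>+x. ennreal (exp (?q x)) \<partial>D) = (\<Sum>k. \<integral>\<^sup>+x. ennreal (?q x ^ k / fact k) \<partial>D)"
    unfolding series by (rule nn_integral_suminf) measurable
  also have "\<dots> \<le> (\<Sum>k. ennreal ((if k = 0 then 1 else 2) * u ^ k))"
  proof (intro suminf_le summableI)
    fix k
    show "(\<integral>\<^sup>+x. ennreal (?q x ^ k / fact k) \<partial>D) \<le> ennreal ((if k = 0 then 1 else 2) * u ^ k)"
      using subgaussian_square_power[OF D \<open>0 \<le> \<theta>\<close>, of k] by (cases "k = 0") (auto simp: u_def emeasure_space_1)
  qed
  also have "\<dots> = ennreal (2 / (1 - u) - 1)"
  proof (rule suminf_ennreal_eq)
    have "(\<lambda>k. 2 * u ^ k) sums (2 * (1 / (1 - u)))"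
      using u by (intro sums_mult geometric_sums) auto
    then have "(\<lambda>k. 2 * u ^ k - (if k = 0 then 1 else 0)) sums (2 * (1 / (1 - u)) - 1)"
      by (intro sums_diff sums_single)
    moreover have "(\<lambda>k. 2 * u ^ k - (if k = 0 then 1 else 0)) = (\<lambda>k. (if k = 0 then 1 else 2) * u ^ k)"
      by auto
    ultimately show "(\<lambda>k. (if k = 0 then 1 else 2) * u ^ k) sums (2 / (1 - u) - 1)" by simp
  qed (use u in auto)
  also have "\<dots> \<le> ennreal (1 + 4 * u)"
  proof (rule ennreal_leI)
    have "u * (2 * u) \<le> u * 1" using u by (intro mult_left_mono) auto
    then show "2 / (1 - u) - 1 \<le> 1 + 4 * u" using u by (simp add: field_simps)
  qed
  also have "\<dots> \<le> ennreal (exp (12 * \<theta>))"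
    using exp_ge_add_one_self[of "4 * u"] by (intro ennreal_leI) (simp add: u_def)
  finally show ?thesis .
qed

lemma exp_neg_le_quadratic:
  assumes "0 \<le> (x::real)"
  shows "exp (- x) \<le> 1 - x + x\<^sup>2 / 2"
proof -
  let ?f = "\<lambda>x::real. 1 - x + x\<^sup>2 / 2 - exp (- x)"
  have "?f 0 \<le> ?f x"
  proof (rule DERIV_nonneg_imp_nondecreasing[OF assms])
    fix y :: real assume "0 \<le> y" "y \<le> x"
    have "(?f has_real_derivative - 1 + y + exp (- y)) (at y)"
      by (auto intro!: derivative_eq_intros)
    moreover have "0 \<le> - 1 + y + exp (- y)" using exp_ge_add_one_self[of "- y"] by simp
    ultimately show "\<exists>d. (?f has_real_derivative d) (at y) \<and> 0 \<le> d" by blast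
  qed
  then show ?thesis by simp
qed

text \<open>
  The square has exponential moments of all negative orders, so the lower tail needs no restriction on
  \<open>l\<close>. A positive variance makes the Bochner integral defining it converge.
\<close>

lemma subgaussian_square_lower_mgf:
  assumes D: "subgaussian_law D 1" and var: "0 < law_variance D" and "0 \<le> l"
  shows "(\<integral>\<^sup>+x. ennreal (exp (l * (law_variance D - (x - law_mean D)\<^sup>2))) \<partial>D) \<le> ennreal (exp (48 * l\<^sup>2))"
proof -
  have [measurable_cong]: "sets D = sets borel" using D by (simp add: subgaussian_law_def)
  interpret prob_space D using D by (simp add: subgaussian_law_def)
  let ?X = "\<lambda>x. x - law_mean D"
  have int2: "integrable D (\<lambda>x. (?X x)\<^sup>2)"
    using var not_integrable_integral_eq[of D "\<lambda>x. (?X x)\<^sup>2"] by (auto simp: law_variance_def)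
  \<comment> \<open>The even moment bound at \<open>t = 1\<close>, \<open>k = 2\<close> with
    \<open>exp (1 / 2) \<le> 2\<close> gives 2 * 24 * 2 = 96; half of it is the 48 in the
    conclusion.\<close>
  have m4: "(\<integral>\<^sup>+x. ennreal (?X x ^ 4) \<partial>D) \<le> ennreal 96"
  proof -
    have "(\<integral>\<^sup>+x. ennreal (?X x ^ 4) \<partial>D) \<le> ennreal (2 * fact 4 * exp (1 / 2))"
      using subgaussian_even_moment[OF D, of 1 2] by simp
    also have "\<dots> \<le> ennreal 96"
    proof (rule ennreal_leI)
      have "(exp (1 / 2))\<^sup>2 \<le> (2::real)\<^sup>2"
        using exp_le by (simp add: power2_eq_square flip: exp_add)
      then have "exp (1 / 2) \<le> (2::real)" by (rule power2_le_imp_le) simp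
      then show "2 * fact 4 * exp (1 / 2) \<le> (96::real)" by (simp add: fact_numeral)
    qed
    finally show ?thesis .
  qed
  have int4: "integrable D (\<lambda>x. ?X x ^ 4)"
    using m4 by (intro integrableI_bounded) (auto simp: order_le_less_trans)
  have "integral\<^sup>L D (\<lambda>x. ?X x ^ 4) \<le> 96"
  proof -
    have "ennreal (integral\<^sup>L D (\<lambda>x. ?X x ^ 4)) \<le> ennreal 96"
      using m4 by (subst (asm) nn_integral_eq_integral[OF int4]) auto
    then show ?thesis by (subst (asm) ennreal_le_iff) auto
  qed
  have int: "integrable D (\<lambda>x. 1 - l * (?X x)\<^sup>2 + l\<^sup>2 / 2 * ?X x ^ 4)"
    using int2 int4 by simp
  have "(\<integral>\<^sup>+x. ennreal (exp (- (l * (?X x)\<^sup>2))) \<partial>D)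
      \<le> (\<integral>\<^sup>+x. ennreal (1 - l * (?X x)\<^sup>2 + l\<^sup>2 / 2 * ?X x ^ 4) \<partial>D)"
  proof (intro nn_integral_mono ennreal_leI)
    fix x
    show "exp (- (l * (?X x)\<^sup>2)) \<le> 1 - l * (?X x)\<^sup>2 + l\<^sup>2 / 2 * ?X x ^ 4"
      using exp_neg_le_quadratic[of "l * (?X x)\<^sup>2"] \<open>0 \<le> l\<close>
      by (simp add: power_mult_distrib flip: power_mult)
  qed
  also have "\<dots> = ennreal (integral\<^sup>L D (\<lambda>x. 1 - l * (?X x)\<^sup>2 + l\<^sup>2 / 2 * ?X x ^ 4))"
  proof (rule nn_integral_eq_integral[OF int], rule AE_I2)
    fix x
    show "0 \<le> 1 - l * (?X x)\<^sup>2 + l\<^sup>2 / 2 * ?X x ^ 4"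
      using order_trans[OF exp_ge_zero exp_neg_le_quadratic[of "l * (?X x)\<^sup>2"]] \<open>0 \<le> l\<close>
      by (simp add: power_mult_distrib flip: power_mult)
  qed
  also have "integral\<^sup>L D (\<lambda>x. 1 - l * (?X x)\<^sup>2 + l\<^sup>2 / 2 * ?X x ^ 4)
      = 1 - l * law_variance D + l\<^sup>2 / 2 * integral\<^sup>L D (\<lambda>x. ?X x ^ 4)"
    using int2 int4 by (simp add: law_variance_def prob_space)
  also have "ennreal \<dots> \<le> ennreal (exp (- l * law_variance D + 48 * l\<^sup>2))"
  proof (rule ennreal_leI)
    have "l\<^sup>2 / 2 * integral\<^sup>L D (\<lambda>x. ?X x ^ 4) \<le> l\<^sup>2 / 2 * 96"
      using \<open>integral\<^sup>L D _ \<le> 96\<close> by (intro mult_left_mono) auto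
    then show "1 - l * law_variance D + l\<^sup>2 / 2 * integral\<^sup>L D (\<lambda>x. ?X x ^ 4)
        \<le> exp (- l * law_variance D + 48 * l\<^sup>2)"
      using exp_ge_add_one_self[of "- l * law_variance D + 48 * l\<^sup>2"] by linarith
  qed
  finally have le: "(\<integral>\<^sup>+x. ennreal (exp (- (l * (?X x)\<^sup>2))) \<partial>D)
      \<le> ennreal (exp (- l * law_variance D + 48 * l\<^sup>2))" .
  have "(\<integral>\<^sup>+x. ennreal (exp (l * (law_variance D - (?X x)\<^sup>2))) \<partial>D)
      = ennreal (exp (l * law_variance D)) * (\<integral>\<^sup>+x. ennreal (exp (- (l * (?X x)\<^sup>2))) \<partial>D)"
    by (subst nn_integral_cmult[symmetric])
      (auto simp: right_diff_distrib simp flip: ennreal_mult exp_add)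
  also have "\<dots> \<le> ennreal (exp (l * law_variance D)) * ennreal (exp (- l * law_variance D + 48 * l\<^sup>2))"
    by (intro mult_left_mono le) simp
  also have "\<dots> = ennreal (exp (48 * l\<^sup>2))" by (simp flip: ennreal_mult exp_add)
  finally show ?thesis .
qed

section \<open>Exponential Markov inequality and product measures\<close>

text \<open>The chosen \<open>l = s / (96 * L^2)\<close> minimizes
  \<open>48 n l^2 L^2 - l n s\<close>, and \<open>s \<le> 48 * L\<close> keeps it in the range where
  the exponential moment is controlled. The constant 48 is common to all tails below: linear sums
  have 1/2, bilinear sums 6, and squares 48.\<close>

lemma measure_chernoff:
  assumes P: "prob_space P" and f[measurable]: "f \<in> borel_measurable P"
    and L: "0 < L" and s: "0 < s" "s \<le> 48 * L"
    and mgf: "\<And>l. 0 \<le> l \<Longrightarrow> l * L \<le> 1 / 2 \<Longrightarrow>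
      (\<integral>\<^sup>+x. ennreal (exp (l * f x)) \<partial>P) \<le> ennreal (exp (48 * real n * l\<^sup>2 * L\<^sup>2))"
  shows "measure P {x \<in> space P. real n * s \<le> f x} \<le> exp (- (real n * s\<^sup>2 / (192 * L\<^sup>2)))"
proof -
  interpret prob_space P by (rule P)
  define l where "l = s / (96 * L\<^sup>2)"
  have l: "0 < l" "l * L \<le> 1 / 2" using L s by (simp_all add: l_def power2_eq_square field_simps)
  let ?a = "l * (real n * s)"
  have "emeasure P {x \<in> space P. real n * s \<le> f x}
      = emeasure P {x \<in> space P. 1 \<le> ennreal (exp (- ?a)) * ennreal (exp (l * f x))}"
  proof (intro arg_cong[where f = "emeasure P"] Collect_cong conj_cong refl)
    fix x
    have "real n * s \<le> f x \<longleftrightarrow> 0 \<le> - ?a + l * f x" using l by simp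
    also have "\<dots> \<longleftrightarrow> 1 \<le> exp (- ?a) * exp (l * f x)" by (simp flip: exp_add)
    finally show "real n * s \<le> f x \<longleftrightarrow> 1 \<le> ennreal (exp (- ?a)) * ennreal (exp (l * f x))"
      by (simp flip: ennreal_mult ennreal_1)
  qed
  also have "\<dots> \<le> ennreal (exp (- ?a)) * (\<integral>\<^sup>+x. ennreal (exp (l * f x)) * indicator (space P) x \<partial>P)"
    by (rule nn_integral_Markov_inequality) auto
  also have "(\<integral>\<^sup>+x. ennreal (exp (l * f x)) * indicator (space P) x \<partial>P) = (\<integral>\<^sup>+x. ennreal (exp (l * f x)) \<partial>P)"
    by (intro nn_integral_cong) simp
  also have "ennreal (exp (- ?a)) * \<dots> \<le> ennreal (exp (- ?a)) * ennreal (exp (48 * real n * l\<^sup>2 * L\<^sup>2))"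
    using l by (intro mult_left_mono mgf) auto
  also have "\<dots> = ennreal (exp (- ?a + 48 * real n * l\<^sup>2 * L\<^sup>2))" by (simp only: exp_add ennreal_mult'[OF exp_ge_zero])
  also have "- ?a + 48 * real n * l\<^sup>2 * L\<^sup>2 = - (real n * s\<^sup>2 / (192 * L\<^sup>2))"
    using L by (simp add: l_def power2_eq_square field_simps)
  finally show ?thesis by (simp add: emeasure_eq_measure)
qed

lemma (in finite_measure) measure_UN_le_card:
  assumes "finite I" "\<And>i. i \<in> I \<Longrightarrow> A i \<in> sets M" "\<And>i. i \<in> I \<Longrightarrow> measure M (A i) \<le> q"
  shows "measure M (\<Union>i\<in>I. A i) \<le> real (card I) * q"
proof -
  have "measure M (\<Union>i\<in>I. A i) \<le> (\<Sum>i\<in>I. measure M (A i))"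
    using assms by (intro finite_measure_subadditive_finite) auto
  also have "\<dots> \<le> real (card I) * q" using assms(3) by (rule sum_bounded_above)
  finally show ?thesis .
qed

text \<open>Coordinates outside the range of \<open>p\<close> get the constant factor 1, whose
  integral is 1, so the full product formula applies. The injection \<open>p\<close> selects a
  column of the matrix or the whole noise vector.\<close>

lemma nn_integral_PiM_prod_inj:
  fixes p :: "nat \<Rightarrow> 'i"
  assumes D: "prob_space D" and I: "finite I" and p: "inj_on p {..<n}" "p ` {..<n} \<subseteq> I"
    and g: "\<And>i. i < n \<Longrightarrow> g i \<in> borel_measurable D"
  shows "(\<integral>\<^sup>+x. (\<Prod>i<n. g i (x (p i))) \<partial>PiM I (\<lambda>_. D)) = (\<Prod>i<n. \<integral>\<^sup>+x. g i x \<partial>D)"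
proof -
  interpret prob_space D by (rule D)
  interpret product_sigma_finite "\<lambda>_::'i. D" by standard
  define r where "r = inv_into {..<n} p"
  have r: "r (p i) = i" if "i < n" for i using p(1) that by (simp add: r_def)
  define h where "h q = (if q \<in> p ` {..<n} then g (r q) else (\<lambda>_. 1))" for q
  have h: "h q \<in> borel_measurable D" if "q \<in> I" for q
    using g r by (auto simp: h_def)
  \<comment> \<open>Applied twice below: with \<open>F\<close> as evaluation at a coordinate of
    \<open>x\<close>, and with \<open>F\<close> as integration over \<open>D\<close>.\<close>
  have restrict: "(\<Prod>q\<in>I. F q (if q \<in> p ` {..<n} then g (r q) else (\<lambda>_. 1))) = (\<Prod>i<n. F (p i) (g i))"
    if "\<And>q. F q (\<lambda>_. 1) = (1::ennreal)" for F
  proof -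
    have "(\<Prod>q\<in>I. F q (if q \<in> p ` {..<n} then g (r q) else (\<lambda>_. 1))) = (\<Prod>q\<in>p ` {..<n}. F q (g (r q)))"
      using I p that by (intro prod.mono_neutral_cong_right) auto
    also have "\<dots> = (\<Prod>i<n. F (p i) (g i))"
      by (subst prod.reindex[OF p(1)]) (simp add: r)
    finally show ?thesis .
  qed
  have "(\<integral>\<^sup>+x. (\<Prod>i<n. g i (x (p i))) \<partial>PiM I (\<lambda>_. D)) = (\<integral>\<^sup>+x. (\<Prod>q\<in>I. h q (x q)) \<partial>PiM I (\<lambda>_. D))"
    unfolding h_def by (subst restrict[of "\<lambda>q k. k (_ q)"]) auto
  also have "\<dots> = (\<Prod>q\<in>I. \<integral>\<^sup>+x. h q x \<partial>D)"
    by (rule product_nn_integral_prod[OF I h])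
  also have "\<dots> = (\<Prod>i<n. \<integral>\<^sup>+x. g i x \<partial>D)"
    unfolding h_def by (rule restrict) (simp add: emeasure_space_1)
  finally show ?thesis .
qed

lemma ennreal_exp_sum:
  "finite A \<Longrightarrow> ennreal (exp (\<Sum>i\<in>A. f i)) = (\<Prod>i\<in>A. ennreal (exp (f i)))"
  by (simp add: exp_sum prod_ennreal)

lemma ennreal_exp_mono: "a \<le> b \<Longrightarrow> ennreal (exp a) \<le> ennreal (exp b)"
  by (intro ennreal_leI) simp

text \<open>The coefficients are arbitrary: they are signs in the tail bounds for linear sums, and a
  frozen sample of the other factor in the bilinear case.\<close>

lemma PiM_linear_mgf:
  fixes p :: "nat \<Rightarrow> 'i"
  assumes D: "subgaussian_law D L" and I: "finite I" and p: "inj_on p {..<n}" "p ` {..<n} \<subseteq> I"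
  shows "(\<integral>\<^sup>+x. ennreal (exp (l * (\<Sum>i<n. c i * (x (p i) - law_mean D)))) \<partial>PiM I (\<lambda>_. D))
    \<le> ennreal (exp (l\<^sup>2 * L\<^sup>2 / 2 * (\<Sum>i<n. (c i)\<^sup>2)))"
proof -
  have [measurable_cong]: "sets D = sets borel" and prob: "prob_space D"
    using D by (simp_all add: subgaussian_law_def)
  have "(\<integral>\<^sup>+x. ennreal (exp (l * (\<Sum>i<n. c i * (x (p i) - law_mean D)))) \<partial>PiM I (\<lambda>_. D))
      = (\<integral>\<^sup>+x. (\<Prod>i<n. ennreal (exp ((l * c i) * (x (p i) - law_mean D)))) \<partial>PiM I (\<lambda>_. D))"
    by (simp add: sum_distrib_left mult.assoc flip: ennreal_exp_sum)
  also have "\<dots> = (\<Prod>i<n. \<integral>\<^sup>+x. ennreal (exp ((l * c i) * (x - law_mean D))) \<partial>D)"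
    by (rule nn_integral_PiM_prod_inj[OF prob I p]) measurable
  also have "\<dots> \<le> (\<Prod>i<n. ennreal (exp ((l * c i)\<^sup>2 * L\<^sup>2 / 2)))"
    by (intro prod_mono_ennreal subgaussian_law_mgf[OF D])
  also have "\<dots> = ennreal (exp (l\<^sup>2 * L\<^sup>2 / 2 * (\<Sum>i<n. (c i)\<^sup>2)))"
    by (simp add: sum_distrib_left power_mult_distrib mult_ac flip: ennreal_exp_sum)
  finally show ?thesis .
qed

text \<open>Integrating first over \<open>y\<close> leaves a Gaussian-type exponential of \<open>x\<close>, which is again a product.\<close>

lemma PiM_bilinear_mgf:
  fixes p :: "nat \<Rightarrow> 'i" and q :: "nat \<Rightarrow> 'j"
  assumes D: "subgaussian_law D 1" and E: "subgaussian_law E L"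
    and I: "finite I" "inj_on p {..<n}" "p ` {..<n} \<subseteq> I"
    and J: "finite J" "inj_on q {..<n}" "q ` {..<n} \<subseteq> J"
    and small: "l\<^sup>2 * L\<^sup>2 \<le> 1 / 3"
  shows "(\<integral>\<^sup>+x. \<integral>\<^sup>+y. ennreal (exp (l * (\<Sum>i<n. (x (p i) - law_mean D) * (y (q i) - law_mean E))))
      \<partial>PiM J (\<lambda>_. E) \<partial>PiM I (\<lambda>_. D)) \<le> ennreal (exp (6 * real n * l\<^sup>2 * L\<^sup>2))"
proof -
  have [measurable_cong]: "sets D = sets borel" and prob: "prob_space D"
    using D by (simp_all add: subgaussian_law_def)
  \<comment> \<open>The assumption \<open>small\<close> is the threshold
    \<open>?\<theta> \<le> 1 / 6\<close> of \<open>subgaussian_exp_square\<close>, and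
    \<open>12 * ?\<theta>\<close> produces the factor 6.\<close>
  let ?\<theta> = "l\<^sup>2 * L\<^sup>2 / 2"
  have "(\<integral>\<^sup>+x. \<integral>\<^sup>+y. ennreal (exp (l * (\<Sum>i<n. (x (p i) - law_mean D) * (y (q i) - law_mean E))))
      \<partial>PiM J (\<lambda>_. E) \<partial>PiM I (\<lambda>_. D))
      \<le> (\<integral>\<^sup>+x. ennreal (exp (?\<theta> * (\<Sum>i<n. (x (p i) - law_mean D)\<^sup>2))) \<partial>PiM I (\<lambda>_. D))"
    by (intro nn_integral_mono PiM_linear_mgf[OF E J])
  also have "\<dots> = (\<integral>\<^sup>+x. (\<Prod>i<n. ennreal (exp (?\<theta> * (x (p i) - law_mean D)\<^sup>2))) \<partial>PiM I (\<lambda>_. D))"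
    by (simp add: sum_distrib_left flip: ennreal_exp_sum)
  also have "\<dots> = (\<Prod>i<n. \<integral>\<^sup>+x. ennreal (exp (?\<theta> * (x - law_mean D)\<^sup>2)) \<partial>D)"
    by (rule nn_integral_PiM_prod_inj[OF prob I]) measurable
  also have "\<dots> \<le> (\<Prod>i<n. ennreal (exp (12 * ?\<theta>)))"
    using small by (intro prod_mono_ennreal subgaussian_exp_square[OF D]) (auto simp: mult_ac)
  also have "\<dots> = ennreal (exp (6 * real n * l\<^sup>2 * L\<^sup>2))"
    by (subst ennreal_exp_sum[symmetric]) (simp_all add: mult_ac)
  finally show ?thesis .
qed

text \<open>Both columns live in one product space. Splitting off column \<open>k\<close> by Fubini
  makes them independent families, and the bilinear bound applies with \<open>D\<close> as both
  laws.\<close>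

lemma PiM_columns_mgf:
  fixes d n :: nat
  assumes D: "subgaussian_law D 1" and jk: "j < d" "k < d" "j \<noteq> k" and small: "l\<^sup>2 \<le> 1 / 3"
  shows "(\<integral>\<^sup>+x. ennreal (exp (l * (\<Sum>i<n. (x (i, j) - law_mean D) * (x (i, k) - law_mean D))))
      \<partial>PiM ({..<n} \<times> {..<d}) (\<lambda>_. D)) \<le> ennreal (exp (6 * real n * l\<^sup>2))"
proof -
  have [measurable_cong]: "sets D = sets borel" and prob: "prob_space D"
    using D by (simp_all add: subgaussian_law_def)
  interpret prob_space D by (rule prob)
  interpret product_sigma_finite "\<lambda>_::nat \<times> nat. D" by standard
  let ?J = "{..<n} \<times> {k}" and ?I = "{..<n} \<times> ({..<d} - {k})"
  have eq: "{..<n} \<times> {..<d} = ?I \<union> ?J" using jk by auto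
  let ?f = "\<lambda>x. ennreal (exp (l * (\<Sum>i<n. (x (i, j) - law_mean D) * (x (i, k) - law_mean D))))"
  have [measurable]: "(\<lambda>x. x (i, c)) \<in> borel_measurable (PiM (?I \<union> ?J) (\<lambda>_. D))" if "i < n" "c < d" for i c
    using that eq by (intro measurable_component_singleton[THEN measurable_compose]) auto
  have f: "?f \<in> borel_measurable (PiM (?I \<union> ?J) (\<lambda>_. D))"
    using jk by measurable
  have "integral\<^sup>N (PiM ({..<n} \<times> {..<d}) (\<lambda>_. D)) ?f
      = (\<integral>\<^sup>+x. \<integral>\<^sup>+y. ?f (merge ?I ?J (x, y)) \<partial>PiM ?J (\<lambda>_. D) \<partial>PiM ?I (\<lambda>_. D))"
    unfolding eq by (rule product_nn_integral_fold[where f = ?f, OF _ _ _ f]) auto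
  also have "\<dots> = (\<integral>\<^sup>+x. \<integral>\<^sup>+y. ennreal (exp (l * (\<Sum>i<n. (x (i, j) - law_mean D) * (y (i, k) - law_mean D))))
      \<partial>PiM ?J (\<lambda>_. D) \<partial>PiM ?I (\<lambda>_. D))"
    using jk by (simp add: merge_def)
  also have "\<dots> \<le> ennreal (exp (6 * real n * l\<^sup>2 * 1\<^sup>2))"
    using small jk by (intro PiM_bilinear_mgf D) (auto simp: inj_on_def)
  finally show ?thesis by simp
qed

section \<open>Tail bounds for the sample\<close>

locale sample =
  fixes n d :: nat and D E :: "real measure" and \<rho> :: real
  assumes D: "subgaussian_law D 1" and E: "subgaussian_law E \<rho>"
    and \<rho>: "0 \<le> \<rho>" and E_mean: "law_mean E = 0"
    and variance_pos: "0 < law_variance D"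
begin

abbreviation "P \<equiv> sample_measure n d D E"
abbreviation "X \<omega> i j \<equiv> fst \<omega> (i, j) - law_mean D"
abbreviation "\<epsilon> \<omega> i \<equiv> snd \<omega> i"

lemma sets_D: "sets D = sets borel" and sets_E: "sets E = sets borel"
  and prob_D: "prob_space D" and prob_E: "prob_space E"
  using D E by (simp_all add: subgaussian_law_def)

lemma prob_PiM: "prob_space (PiM ({..<n} \<times> {..<d}) (\<lambda>_. D))" "prob_space (PiM {..<n} (\<lambda>_. E))"
  by (auto intro: prob_space_PiM prob_D prob_E)

lemma prob_P: "prob_space P"
proof -
  interpret pair_prob_space "PiM ({..<n} \<times> {..<d}) (\<lambda>_. D)" "PiM {..<n} (\<lambda>_. E)"
    using prob_PiM by (simp add: pair_prob_space_def pair_sigma_finite_def prob_space_imp_sigma_finite)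
  show ?thesis unfolding sample_measure_def by unfold_locales
qed

lemmas measurable_entries [measurable] = measurable_sample_entries[OF sets_D sets_E]

lemma nn_integral_sample:
  assumes "f \<in> borel_measurable P"
  shows "integral\<^sup>N P f = (\<integral>\<^sup>+x. \<integral>\<^sup>+y. f (x, y) \<partial>PiM {..<n} (\<lambda>_. E) \<partial>PiM ({..<n} \<times> {..<d}) (\<lambda>_. D))"
proof -
  interpret sigma_finite_measure "PiM {..<n} (\<lambda>_. E)"
    using prob_PiM(2) by (rule prob_space_imp_sigma_finite)
  show ?thesis using assms unfolding sample_measure_def by (rule nn_integral_fst[symmetric])
qed

lemma nn_integral_sample_fst:
  assumes "(\<lambda>\<omega>. f (fst \<omega>)) \<in> borel_measurable P"
  shows "(\<integral>\<^sup>+\<omega>. f (fst \<omega>) \<partial>P) = (\<integral>\<^sup>+x. f x \<partial>PiM ({..<n} \<times> {..<d}) (\<lambda>_. D))"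
  using nn_integral_sample[OF assms] by (simp add: prob_space.emeasure_space_1[OF prob_PiM(2)])

lemma nn_integral_sample_snd:
  assumes "(\<lambda>\<omega>. f (snd \<omega>)) \<in> borel_measurable P"
  shows "(\<integral>\<^sup>+\<omega>. f (snd \<omega>) \<partial>P) = (\<integral>\<^sup>+y. f y \<partial>PiM {..<n} (\<lambda>_. E))"
  using nn_integral_sample[OF assms] by (simp add: prob_space.emeasure_space_1[OF prob_PiM(1)])

text \<open>The sign \<open>c\<close> treats upper and lower deviations at once and leaves the
  exponent through \<open>c^2 = 1\<close>.\<close>

lemma entry_sum_tail:
  assumes j: "j < d" and c: "c\<^sup>2 = 1" and s: "0 < s" "s \<le> 48"
  shows "measure P {\<omega> \<in> space P. real n * s \<le> c * (\<Sum>i<n. X \<omega> i j)} \<le> exp (- (real n * s\<^sup>2 / 192))"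
proof -
  have "measure P {\<omega> \<in> space P. real n * s \<le> c * (\<Sum>i<n. X \<omega> i j)} \<le> exp (- (real n * s\<^sup>2 / (192 * 1\<^sup>2)))"
  proof (rule measure_chernoff[OF prob_P])
    show m: "(\<lambda>\<omega>. c * (\<Sum>i<n. X \<omega> i j)) \<in> borel_measurable P" using j by measurable
    fix l :: real
    have "(\<integral>\<^sup>+\<omega>. ennreal (exp (l * (c * (\<Sum>i<n. X \<omega> i j)))) \<partial>P)
        = (\<integral>\<^sup>+x. ennreal (exp (l * (c * (\<Sum>i<n. x (i, j) - law_mean D)))) \<partial>PiM ({..<n} \<times> {..<d}) (\<lambda>_. D))"
      using j by (intro nn_integral_sample_fst) measurable
    also have "\<dots> = (\<integral>\<^sup>+x. ennreal (exp (l * (\<Sum>i<n. c * (x (i, j) - law_mean D)))) \<partial>PiM ({..<n} \<times> {..<d}) (\<lambda>_. D))"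
      by (simp add: sum_distrib_left)
    also have "\<dots> \<le> ennreal (exp (l\<^sup>2 * 1\<^sup>2 / 2 * (\<Sum>i<n. c\<^sup>2)))"
      using j by (intro PiM_linear_mgf[OF D]) (auto simp: inj_on_def)
    also have "\<dots> \<le> ennreal (exp (48 * real n * l\<^sup>2 * 1\<^sup>2))"
      by (intro ennreal_exp_mono) (simp add: c)
    finally show "(\<integral>\<^sup>+\<omega>. ennreal (exp (l * (c * (\<Sum>i<n. X \<omega> i j)))) \<partial>P) \<le> ennreal (exp (48 * real n * l\<^sup>2 * 1\<^sup>2))" .
  qed (use s in auto)
  then show ?thesis by simp
qed

lemma column_product_tail:
  assumes jk: "j < d" "k < d" "j \<noteq> k" and c: "c\<^sup>2 = 1" and s: "0 < s" "s \<le> 48"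
  shows "measure P {\<omega> \<in> space P. real n * s \<le> c * (\<Sum>i<n. X \<omega> i j * X \<omega> i k)} \<le> exp (- (real n * s\<^sup>2 / 192))"
proof -
  have "measure P {\<omega> \<in> space P. real n * s \<le> c * (\<Sum>i<n. X \<omega> i j * X \<omega> i k)} \<le> exp (- (real n * s\<^sup>2 / (192 * 1\<^sup>2)))"
  proof (rule measure_chernoff[OF prob_P])
    show m: "(\<lambda>\<omega>. c * (\<Sum>i<n. X \<omega> i j * X \<omega> i k)) \<in> borel_measurable P" using jk by measurable
    fix l :: real assume l: "0 \<le> l" "l * 1 \<le> 1 / 2"
    then have "l\<^sup>2 \<le> (1 / 2)\<^sup>2" by (intro power_mono) auto
    then have small: "(l * c)\<^sup>2 \<le> 1 / 3" by (simp add: power_mult_distrib c power_divide)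
    have "(\<integral>\<^sup>+\<omega>. ennreal (exp (l * (c * (\<Sum>i<n. X \<omega> i j * X \<omega> i k)))) \<partial>P)
        = (\<integral>\<^sup>+x. ennreal (exp (l * (c * (\<Sum>i<n. (x (i, j) - law_mean D) * (x (i, k) - law_mean D)))))
            \<partial>PiM ({..<n} \<times> {..<d}) (\<lambda>_. D))"
      using jk by (intro nn_integral_sample_fst) measurable
    also have "\<dots> \<le> ennreal (exp (6 * real n * (l * c)\<^sup>2))"
      using PiM_columns_mgf[OF D jk small] by (simp add: mult.assoc)
    also have "\<dots> \<le> ennreal (exp (48 * real n * l\<^sup>2 * 1\<^sup>2))"
      by (intro ennreal_exp_mono) (simp add: power_mult_distrib c)
    finally show "(\<integral>\<^sup>+\<omega>. ennreal (exp (l * (c * (\<Sum>i<n. X \<omega> i j * X \<omega> i k)))) \<partial>P) \<le> ennreal (exp (48 * real n * l\<^sup>2 * 1\<^sup>2))" .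
  qed (use s in auto)
  then show ?thesis by simp
qed

text \<open>One-sided, matching the lower bound on the diagonal of the Gram matrix in
  \<open>objective_lower\<close>.\<close>

lemma column_square_tail:
  assumes j: "j < d" and s: "0 < s" "s \<le> 48"
  shows "measure P {\<omega> \<in> space P. real n * s \<le> (\<Sum>i<n. law_variance D - (X \<omega> i j)\<^sup>2)} \<le> exp (- (real n * s\<^sup>2 / 192))"
proof -
  note [measurable_cong] = sets_D
  have "measure P {\<omega> \<in> space P. real n * s \<le> (\<Sum>i<n. law_variance D - (X \<omega> i j)\<^sup>2)} \<le> exp (- (real n * s\<^sup>2 / (192 * 1\<^sup>2)))"
  proof (rule measure_chernoff[OF prob_P])
    show m: "(\<lambda>\<omega>. \<Sum>i<n. law_variance D - (X \<omega> i j)\<^sup>2) \<in> borel_measurable P" using j by measurable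
    fix l :: real assume l: "0 \<le> l"
    have "(\<integral>\<^sup>+\<omega>. ennreal (exp (l * (\<Sum>i<n. law_variance D - (X \<omega> i j)\<^sup>2))) \<partial>P)
        = (\<integral>\<^sup>+x. ennreal (exp (l * (\<Sum>i<n. law_variance D - (x (i, j) - law_mean D)\<^sup>2)))
            \<partial>PiM ({..<n} \<times> {..<d}) (\<lambda>_. D))"
      using j by (intro nn_integral_sample_fst) measurable
    also have "\<dots> = (\<integral>\<^sup>+x. (\<Prod>i<n. ennreal (exp (l * (law_variance D - (x (i, j) - law_mean D)\<^sup>2))))
            \<partial>PiM ({..<n} \<times> {..<d}) (\<lambda>_. D))"
      by (simp add: sum_distrib_left flip: ennreal_exp_sum)
    also have "\<dots> = (\<Prod>i<n. \<integral>\<^sup>+x. ennreal (exp (l * (law_variance D - (x - law_mean D)\<^sup>2))) \<partial>D)"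
      using j by (intro nn_integral_PiM_prod_inj[OF prob_D]) (auto simp: inj_on_def)
    also have "\<dots> \<le> (\<Prod>i<n. ennreal (exp (48 * l\<^sup>2)))"
      by (intro prod_mono_ennreal subgaussian_square_lower_mgf D variance_pos l)
    also have "\<dots> = ennreal (exp (48 * real n * l\<^sup>2 * 1\<^sup>2))"
      by (subst ennreal_exp_sum[symmetric]) (simp_all add: mult_ac)
    finally show "(\<integral>\<^sup>+\<omega>. ennreal (exp (l * (\<Sum>i<n. law_variance D - (X \<omega> i j)\<^sup>2))) \<partial>P) \<le> ennreal (exp (48 * real n * l\<^sup>2 * 1\<^sup>2))" .
  qed (use s in auto)
  then show ?thesis by simp
qed

text \<open>A nonzero mean of the entries multiplies the plain noise average, so this average has to
  be small too. The scale \<open>R\<close> replaces \<rho> because it must be positive and large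
  enough to admit \<open>s\<close>.\<close>

lemma noise_sum_tail:
  assumes c: "c\<^sup>2 = 1" and R: "0 < R" "\<rho> \<le> R" and s: "0 < s" "s \<le> 48 * R"
  shows "measure P {\<omega> \<in> space P. real n * s \<le> c * (\<Sum>i<n. \<epsilon> \<omega> i)} \<le> exp (- (real n * s\<^sup>2 / (192 * R\<^sup>2)))"
proof (rule measure_chernoff[OF prob_P])
  show m: "(\<lambda>\<omega>. c * (\<Sum>i<n. \<epsilon> \<omega> i)) \<in> borel_measurable P" by measurable
  fix l :: real
  have "(\<integral>\<^sup>+\<omega>. ennreal (exp (l * (c * (\<Sum>i<n. \<epsilon> \<omega> i)))) \<partial>P)
      = (\<integral>\<^sup>+y. ennreal (exp (l * (c * (\<Sum>i<n. y i)))) \<partial>PiM {..<n} (\<lambda>_. E))"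
    using m by (intro nn_integral_sample_snd) measurable
  also have "\<dots> = (\<integral>\<^sup>+y. ennreal (exp (l * (\<Sum>i<n. c * (y i - law_mean E)))) \<partial>PiM {..<n} (\<lambda>_. E))"
    by (simp add: sum_distrib_left E_mean)
  also have "\<dots> \<le> ennreal (exp (l\<^sup>2 * \<rho>\<^sup>2 / 2 * (\<Sum>i<n. c\<^sup>2)))"
    using PiM_linear_mgf[OF E, of "{..<n}" "\<lambda>i. i" n l "\<lambda>_. c"] by (simp add: inj_on_def)
  also have "\<dots> \<le> ennreal (exp (48 * real n * l\<^sup>2 * R\<^sup>2))"
  proof (intro ennreal_exp_mono)
    have "real n * l\<^sup>2 * \<rho>\<^sup>2 \<le> real n * l\<^sup>2 * R\<^sup>2"
      using R \<rho> by (intro mult_left_mono power_mono) auto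
    moreover have "0 \<le> real n * l\<^sup>2 * R\<^sup>2" by simp
    moreover have "l\<^sup>2 * \<rho>\<^sup>2 / 2 * (\<Sum>i<n. c\<^sup>2) = real n * l\<^sup>2 * \<rho>\<^sup>2 / 2" by (simp add: c)
    ultimately show "l\<^sup>2 * \<rho>\<^sup>2 / 2 * (\<Sum>i<n. c\<^sup>2) \<le> 48 * real n * l\<^sup>2 * R\<^sup>2" by linarith
  qed
  finally show "(\<integral>\<^sup>+\<omega>. ennreal (exp (l * (c * (\<Sum>i<n. \<epsilon> \<omega> i)))) \<partial>P) \<le> ennreal (exp (48 * real n * l\<^sup>2 * R\<^sup>2))" .
qed (use R s in auto)

lemma noise_product_tail:
  assumes j: "j < d" and c: "c\<^sup>2 = 1" and R: "0 < R" "\<rho> \<le> R" and s: "0 < s" "s \<le> 48 * R"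
  shows "measure P {\<omega> \<in> space P. real n * s \<le> c * (\<Sum>i<n. X \<omega> i j * \<epsilon> \<omega> i)} \<le> exp (- (real n * s\<^sup>2 / (192 * R\<^sup>2)))"
proof (rule measure_chernoff[OF prob_P])
  show m: "(\<lambda>\<omega>. c * (\<Sum>i<n. X \<omega> i j * \<epsilon> \<omega> i)) \<in> borel_measurable P" using j by measurable
  fix l :: real assume l: "0 \<le> l" "l * R \<le> 1 / 2"
  have le: "l\<^sup>2 * \<rho>\<^sup>2 \<le> l\<^sup>2 * R\<^sup>2" using R \<rho> by (intro mult_left_mono power_mono) auto
  have "(l * R)\<^sup>2 \<le> (1 / 2)\<^sup>2" using l R by (intro power_mono) auto
  then have small: "(l * c)\<^sup>2 * \<rho>\<^sup>2 \<le> 1 / 3"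
    using le by (simp add: power_mult_distrib c power_divide)
  have "(\<integral>\<^sup>+\<omega>. ennreal (exp (l * (c * (\<Sum>i<n. X \<omega> i j * \<epsilon> \<omega> i)))) \<partial>P)
      = (\<integral>\<^sup>+x. \<integral>\<^sup>+y. ennreal (exp ((l * c) * (\<Sum>i<n. (x (i, j) - law_mean D) * (y i - law_mean E))))
          \<partial>PiM {..<n} (\<lambda>_. E) \<partial>PiM ({..<n} \<times> {..<d}) (\<lambda>_. D))"
    by (subst nn_integral_sample) (use m in \<open>simp_all add: E_mean mult.assoc\<close>)
  also have "\<dots> \<le> ennreal (exp (6 * real n * (l * c)\<^sup>2 * \<rho>\<^sup>2))"
    using j small by (intro PiM_bilinear_mgf[OF D E]) (auto simp: inj_on_def)
  also have "\<dots> \<le> ennreal (exp (48 * real n * l\<^sup>2 * R\<^sup>2))"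
  proof (intro ennreal_exp_mono)
    have "6 * real n * (l\<^sup>2 * \<rho>\<^sup>2) \<le> 48 * real n * (l\<^sup>2 * R\<^sup>2)"
      by (intro mult_mono[OF _ le]) auto
    then show "6 * real n * (l * c)\<^sup>2 * \<rho>\<^sup>2 \<le> 48 * real n * l\<^sup>2 * R\<^sup>2"
      by (simp add: power_mult_distrib c mult.assoc)
  qed
  finally show "(\<integral>\<^sup>+\<omega>. ennreal (exp (l * (c * (\<Sum>i<n. X \<omega> i j * \<epsilon> \<omega> i)))) \<partial>P)
      \<le> ennreal (exp (48 * real n * l\<^sup>2 * R\<^sup>2))" .
qed (use R s in auto)

text \<open>Each entry is its mean plus a centered part, so Gram entries and noise correlations are
  combinations of four kinds of averages. A union bound makes all of them small simultaneously, and
  \<open>sdp_recoversI\<close> applies off the bad event.\<close>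

lemma recovery_probability:
  assumes \<sigma>: "0 < \<sigma>" "\<sigma> \<le> d" and n: "0 < n" and a: "a \<in> carrier_vec \<sigma>" "\<forall>i<\<sigma>. a $ i \<in> {-1, 1}"
    and v: "0 < v" "v \<le> 1" "v \<le> law_variance D" and \<mu>: "\<bar>law_mean D\<bar> \<le> \<mu>"
    and \<kappa>: "\<kappa> = v / (48 * (\<mu> + 1))"
    and size: "576 / \<kappa>\<^sup>2 * ((real \<sigma>)\<^sup>2 + \<rho>\<^sup>2) * ln (real d) \<le> real n"
  shows "1 - 8 / real d \<le> measure P (recovery_event n d \<sigma> D E (a @\<^sub>v 0\<^sub>v (d - \<sigma>)))"
proof -
  interpret prob_space P by (rule prob_P)
  define z where "z = a @\<^sub>v 0\<^sub>v (d - \<sigma>)"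
  define m where "m = law_mean D"
  \<comment> \<open>\<open>R\<close> dominates 1, \<rho> and \<sigma>. It is a valid noise scale
    even for \<open>\<rho> = 0\<close>, and \<open>s = \<kappa> / \<sigma>\<close> is at least
    \<open>\<kappa> / R\<close>, so all tails share the exponent
    \<open>n \<kappa>^2 / (192 R^2)\<close>.\<close>
  define R where "R = sqrt ((real \<sigma>)\<^sup>2 + \<rho>\<^sup>2)"
  define s where "s = \<kappa> / real \<sigma>"
  define q where "q = 1 / real d ^ 3"
  have z: "z \<in> carrier_vec d" "\<And>i. i < \<sigma> \<Longrightarrow> z $ i \<in> {-1, 1}" "\<And>i. i < d \<Longrightarrow> \<sigma> \<le> i \<Longrightarrow> z $ i = 0"
    using append_carrier_vec[OF a(1) zero_carrier_vec[of "d - \<sigma>"]] a \<sigma> by (auto simp: z_def)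
  have "0 \<le> \<mu>" using \<mu> by linarith
  have \<kappa>_pos: "0 < \<kappa>" and \<kappa>_le: "\<kappa> \<le> 1"
    using v \<open>0 \<le> \<mu>\<close> by (auto simp: \<kappa> field_simps)
  have \<sigma>1: "1 \<le> real \<sigma>" and d: "1 \<le> real d" using \<sigma> by auto
  have R2: "R\<^sup>2 = (real \<sigma>)\<^sup>2 + \<rho>\<^sup>2" by (simp add: R_def)
  have R: "1 \<le> R" "\<rho> \<le> R" "real \<sigma> \<le> R"
  proof -
    show "real \<sigma> \<le> R" "\<rho> \<le> R" unfolding R_def by (intro real_le_rsqrt; simp)+
    then show "1 \<le> R" using \<sigma>1 by linarith
  qed
  have s: "0 < s" "s \<le> 48" using \<kappa>_pos \<kappa>_le \<sigma>1 by (simp_all add: s_def field_simps)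
  have tail: "exp (- (real n * \<kappa>\<^sup>2 / (192 * R\<^sup>2))) \<le> q"
  proof -
    \<comment> \<open>Here 576 = 3 * 192: each bad event gets probability at most \<open>d\<close>
      to the power -3, enough for order \<open>d^2\<close> events.\<close>
    have "3 * ln (real d) \<le> real n * \<kappa>\<^sup>2 / (192 * R\<^sup>2)"
      using size \<kappa>_pos R unfolding R2[symmetric] by (simp add: field_simps)
    then have "exp (- (real n * \<kappa>\<^sup>2 / (192 * R\<^sup>2))) \<le> exp (- (3 * ln (real d)))" by simp
    also have "\<dots> = q"
      using d exp_of_nat_mult[of 3 "ln (real d)"] by (simp add: q_def exp_minus inverse_eq_divide)
    finally show ?thesis .
  qed
  have tail': "exp (- (real n * s\<^sup>2 / 192)) \<le> q"
  proof -
    have "(real \<sigma>)\<^sup>2 \<le> R\<^sup>2" using R(3) by (intro power_mono) auto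
    then have "\<kappa>\<^sup>2 / R\<^sup>2 \<le> s\<^sup>2"
      using \<sigma> R(1) unfolding s_def power_divide by (intro divide_left_mono mult_pos_pos) auto
    then have "real n / 192 * (\<kappa>\<^sup>2 / R\<^sup>2) \<le> real n / 192 * s\<^sup>2" by (intro mult_left_mono) auto
    then have "exp (- (real n * s\<^sup>2 / 192)) \<le> exp (- (real n * \<kappa>\<^sup>2 / (192 * R\<^sup>2)))" by simp
    then show ?thesis using tail by linarith
  qed
  define B1 where "B1 = (\<lambda>(j, c). {\<omega> \<in> space P. real n * s \<le> c * (\<Sum>i<n. X \<omega> i j)})"
  \<comment> \<open>Diagonal pairs carry the one-sided event for squares, the same for both signs,
    so that the index set is a plain product.\<close>
  define B2 where "B2 = (\<lambda>(j, k, c). {\<omega> \<in> space P. real n * s \<le> (if j = k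
    then (\<Sum>i<n. law_variance D - (X \<omega> i j)\<^sup>2) else c * (\<Sum>i<n. X \<omega> i j * X \<omega> i k))})"
  define B3 where "B3 c = {\<omega> \<in> space P. real n * \<kappa> \<le> c * (\<Sum>i<n. \<epsilon> \<omega> i)}" for c
  define B4 where "B4 = (\<lambda>(j, c). {\<omega> \<in> space P. real n * \<kappa> \<le> c * (\<Sum>i<n. X \<omega> i j * \<epsilon> \<omega> i)})"
  let ?sg = "{-1, 1 :: real}"
  let ?I1 = "{..<d} \<times> ?sg" and ?I2 = "{..<d} \<times> {..<d} \<times> ?sg"
  have sg: "c\<^sup>2 = 1" if "c \<in> ?sg" for c using that by auto
  have \<kappa>R: "\<kappa> \<le> 48 * R" "0 < R" using \<kappa>_le R by simp_all
  have sets: "i \<in> ?I1 \<Longrightarrow> B1 i \<in> sets P" "p \<in> ?I2 \<Longrightarrow> B2 p \<in> sets P" "B3 c \<in> sets P" "i \<in> ?I1 \<Longrightarrow> B4 i \<in> sets P"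
    for i p c
  proof -
    show "B1 i \<in> sets P" if "i \<in> ?I1" using that by (cases i) (auto simp: B1_def)
    show "B2 p \<in> sets P" if "p \<in> ?I2" using that by (cases p) (auto simp: B2_def)
    show "B3 c \<in> sets P" unfolding B3_def by measurable
    show "B4 i \<in> sets P" if "i \<in> ?I1" using that by (cases i) (auto simp: B4_def)
  qed
  have m1: "measure P (\<Union>i\<in>?I1. B1 i) \<le> real (card ?I1) * q"
  proof (rule measure_UN_le_card)
    fix i assume "i \<in> ?I1"
    then obtain j c where i: "i = (j, c)" and jc: "j < d" "c \<in> ?sg" by auto
    show "measure P (B1 i) \<le> q"
      using order_trans[OF entry_sum_tail[OF jc(1) sg[OF jc(2)] s] tail'] by (simp add: B1_def i)
  qed (auto intro: sets)
  have m2: "measure P (\<Union>p\<in>?I2. B2 p) \<le> real (card ?I2) * q"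
  proof (rule measure_UN_le_card)
    fix p assume "p \<in> ?I2"
    then obtain j k c where p: "p = (j, k, c)" and jk: "j < d" "k < d" "c \<in> ?sg" by auto
    show "measure P (B2 p) \<le> q"
    proof (cases "j = k")
      case True
      then show ?thesis using order_trans[OF column_square_tail[OF jk(1) s] tail'] by (simp add: B2_def p)
    next
      case False
      then show ?thesis
        using order_trans[OF column_product_tail[OF jk(1,2) False sg[OF jk(3)] s] tail'] by (simp add: B2_def p)
    qed
  qed (auto intro: sets)
  have m3: "measure P (\<Union>c\<in>?sg. B3 c) \<le> real (card ?sg) * q"
  proof (rule measure_UN_le_card)
    show "measure P (B3 c) \<le> q" if "c \<in> ?sg" for c
      using order_trans[OF noise_sum_tail[OF sg[OF that] \<kappa>R(2) R(2) \<kappa>_pos \<kappa>R(1)] tail] by (simp add: B3_def)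
  qed (auto intro: sets)
  have m4: "measure P (\<Union>i\<in>?I1. B4 i) \<le> real (card ?I1) * q"
  proof (rule measure_UN_le_card)
    fix i assume "i \<in> ?I1"
    then obtain j c where i: "i = (j, c)" and jc: "j < d" "c \<in> ?sg" by auto
    show "measure P (B4 i) \<le> q"
      using order_trans[OF noise_product_tail[OF jc(1) sg[OF jc(2)] \<kappa>R(2) R(2) \<kappa>_pos \<kappa>R(1)] tail]
      by (simp add: B4_def i)
  qed (auto intro: sets)
  define B where "B = (\<Union>i\<in>?I1. B1 i) \<union> (\<Union>p\<in>?I2. B2 p) \<union> (\<Union>c\<in>?sg. B3 c) \<union> (\<Union>i\<in>?I1. B4 i)"
  have sets_Un: "(\<Union>i\<in>?I1. B1 i) \<in> sets P" "(\<Union>p\<in>?I2. B2 p) \<in> sets P" "(\<Union>c\<in>?sg. B3 c) \<in> sets P"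
    "(\<Union>i\<in>?I1. B4 i) \<in> sets P"
    by (auto intro!: sets.finite_UN sets simp del: UN_insert)
  have B: "B \<in> sets P" unfolding B_def by (intro sets.Un sets_Un)
  have "measure P B \<le> real (card ?I1) * q + real (card ?I2) * q + real (card ?sg) * q + real (card ?I1) * q"
    unfolding B_def
    by (intro order_trans[OF measure_Un_le] add_mono m1 m2 m3 m4 sets.Un sets_Un)
  \<comment> \<open>The linear and noise-product families have \<open>2 d\<close> events each, the
    pairs \<open>2 d^2\<close>, and the noise average 2.\<close>
  also have "\<dots> = (4 * real d + 2 * (real d)\<^sup>2 + 2) * q"
    by (simp add: card_cartesian_product power2_eq_square algebra_simps)
  also have "\<dots> \<le> (8 * (real d)\<^sup>2) * q"
  proof (rule mult_right_mono)
    have "real d \<le> (real d)\<^sup>2" "1 \<le> (real d)\<^sup>2" using d by (simp_all add: self_le_power)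
    then show "4 * real d + 2 * (real d)\<^sup>2 + 2 \<le> 8 * (real d)\<^sup>2" by linarith
  qed (simp add: q_def)
  also have "\<dots> = 8 / real d" using d by (simp add: q_def power2_eq_square power3_eq_cube)
  finally have meas_B: "measure P B \<le> 8 / real d" .
  have "space P - B \<subseteq> recovery_event n d \<sigma> D E z"
  proof
    fix \<omega> assume \<omega>: "\<omega> \<in> space P - B"
    have nB1: "\<And>j c. j < d \<Longrightarrow> c \<in> ?sg \<Longrightarrow> \<omega> \<notin> B1 (j, c)"
      and nB2: "\<And>j k c. j < d \<Longrightarrow> k < d \<Longrightarrow> c \<in> ?sg \<Longrightarrow> \<omega> \<notin> B2 (j, k, c)"
      and nB3: "\<And>c. c \<in> ?sg \<Longrightarrow> \<omega> \<notin> B3 c"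
      and nB4: "\<And>j c. j < d \<Longrightarrow> c \<in> ?sg \<Longrightarrow> \<omega> \<notin> B4 (j, c)"
      using \<omega> by (auto simp: B_def simp del: UN_insert)
    have lin: "\<bar>\<Sum>i<n. X \<omega> i j\<bar> / real n \<le> s" if "j < d" for j
    proof -
      have "\<bar>\<Sum>i<n. X \<omega> i j\<bar> \<le> real n * s"
        using nB1[OF that, of 1] nB1[OF that, of "-1"] \<omega> by (auto simp: B1_def abs_le_iff)
      then show ?thesis using n by (simp add: field_simps)
    qed
    have prod: "\<bar>\<Sum>i<n. X \<omega> i j * X \<omega> i k\<bar> / real n \<le> s" if "j < d" "k < d" "j \<noteq> k" for j k
    proof -
      have "\<bar>\<Sum>i<n. X \<omega> i j * X \<omega> i k\<bar> \<le> real n * s"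
        using nB2[OF that(1,2), of 1] nB2[OF that(1,2), of "-1"] \<omega> that(3) by (auto simp: B2_def abs_le_iff)
      then show ?thesis using n by (simp add: field_simps)
    qed
    have sq: "law_variance D - s \<le> (\<Sum>i<n. X \<omega> i j * X \<omega> i j) / real n" if "j < d" for j
    proof -
      have "(\<Sum>i<n. law_variance D - (X \<omega> i j)\<^sup>2) \<le> real n * s"
        using nB2[OF that that, of 1] \<omega> by (auto simp: B2_def)
      then have "real n * (law_variance D - s) \<le> (\<Sum>i<n. X \<omega> i j * X \<omega> i j)"
        unfolding sum_subtractf[of "\<lambda>_. law_variance D"] power2_eq_square
        by (simp add: right_diff_distrib)
      then show ?thesis using n by (simp add: pos_le_divide_eq mult.commute)
    qed
    have noise: "\<bar>\<Sum>i<n. \<epsilon> \<omega> i\<bar> / real n \<le> \<kappa>"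
    proof -
      have "\<bar>\<Sum>i<n. \<epsilon> \<omega> i\<bar> \<le> real n * \<kappa>"
        using nB3[of 1] nB3[of "-1"] \<omega> by (auto simp: B3_def abs_le_iff)
      then show ?thesis using n by (simp add: field_simps)
    qed
    have cross: "\<bar>\<Sum>i<n. X \<omega> i j * \<epsilon> \<omega> i\<bar> / real n \<le> \<kappa>" if "j < d" for j
    proof -
      have "\<bar>\<Sum>i<n. X \<omega> i j * \<epsilon> \<omega> i\<bar> \<le> real n * \<kappa>"
        using nB4[OF that, of 1] nB4[OF that, of "-1"] \<omega> by (auto simp: B4_def abs_le_iff)
      then show ?thesis using n by (simp add: field_simps)
    qed
    \<comment> \<open>Expanding a Gram entry gives two mean terms of size at most
      \<open>\<mu> * s\<close> and a centered one of size \<open>s\<close>; a noise correlation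
      splits into \<open>\<mu> * \<kappa>\<close> and \<kappa>.\<close>
    define \<eta> where "\<eta> = (2 * \<mu> + 1) * s"
    define \<delta> where "\<delta> = (\<mu> + 1) * \<kappa>"
    have \<eta>_eq: "\<eta> = 2 * (\<mu> * s) + s" and \<delta>_eq: "\<delta> = \<mu> * \<kappa> + \<kappa>"
      by (simp_all add: \<eta>_def \<delta>_def algebra_simps)
    let ?M = "mat n d (fst \<omega>)" and ?e = "vec n (snd \<omega>)"
    have gram: "(\<Sum>r<n. ?M $$ (r, j) * ?M $$ (r, k)) / real n = m\<^sup>2 + m * ((\<Sum>i<n. X \<omega> i j) / real n)
        + m * ((\<Sum>i<n. X \<omega> i k) / real n) + (\<Sum>i<n. X \<omega> i j * X \<omega> i k) / real n"
      if "j < d" "k < d" for j k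
    proof -
      have "(\<Sum>r<n. ?M $$ (r, j) * ?M $$ (r, k))
          = (\<Sum>i<n. m\<^sup>2 + m * X \<omega> i j + m * X \<omega> i k + X \<omega> i j * X \<omega> i k)"
        using that by (intro sum.cong) (auto simp: m_def power2_eq_square algebra_simps)
      then show ?thesis
        using n by (simp only: sum.distrib sum_distrib_left[symmetric] add_divide_distrib) simp
    qed
    have mX: "\<bar>m * ((\<Sum>i<n. X \<omega> i j) / real n)\<bar> \<le> \<mu> * s" if "j < d" for j
      unfolding abs_mult using \<mu> lin[OF that] \<open>0 \<le> \<mu>\<close> by (intro mult_mono) (auto simp: m_def)
    have "sdp_recovers ?M (?M *\<^sub>v z + ?e) \<sigma> z"
    proof (rule sdp_recoversI[OF _ _ z(1) \<sigma>(2) z(2,3), where m = m and v = v and \<eta> = \<eta> and \<delta> = \<delta>])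
      show "\<bar>(\<Sum>r<n. ?M $$ (r, j) * ?M $$ (r, k)) / real n - m\<^sup>2\<bar> \<le> \<eta>" if "j < d" "k < d" "j \<noteq> k" for j k
      proof -
        have abs3: "\<bar>y + a + b + c - y\<bar> \<le> 2 * A + B" if "\<bar>a\<bar> \<le> A" "\<bar>b\<bar> \<le> A" "\<bar>c\<bar> \<le> B"
          for a b c y A B :: real using that by linarith
        have "\<bar>(\<Sum>i<n. X \<omega> i j * X \<omega> i k) / real n\<bar> \<le> s" using prod[OF that] by simp
        then show ?thesis
          unfolding gram[OF that(1,2)] \<eta>_eq by (intro abs3 mX that)
      qed
      show "m\<^sup>2 + v - \<eta> \<le> (\<Sum>r<n. ?M $$ (r, j) * ?M $$ (r, j)) / real n" if "j < d" for j
      proof -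
        have "y + v - (2 * A + s) \<le> y + b + b + c" if "\<bar>b\<bar> \<le> A" "law_variance D - s \<le> c"
          for b c y A :: real using that v(3) by linarith
        then show ?thesis unfolding gram[OF that that] \<eta>_eq using mX[OF that] sq[OF that] by blast
      qed
      show "\<bar>(\<Sum>r<n. ?M $$ (r, j) * ?e $ r) / real n\<bar> \<le> \<delta>" if "j < d" for j
      proof -
        have "(\<Sum>r<n. ?M $$ (r, j) * ?e $ r) = (\<Sum>i<n. m * \<epsilon> \<omega> i + X \<omega> i j * \<epsilon> \<omega> i)"
          using that by (intro sum.cong) (auto simp: m_def algebra_simps)
        then have eq: "(\<Sum>r<n. ?M $$ (r, j) * ?e $ r) / real n
            = m * ((\<Sum>i<n. \<epsilon> \<omega> i) / real n) + (\<Sum>i<n. X \<omega> i j * \<epsilon> \<omega> i) / real n"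
          by (simp only: sum.distrib sum_distrib_left[symmetric] add_divide_distrib) simp
        have "\<bar>m * ((\<Sum>i<n. \<epsilon> \<omega> i) / real n)\<bar> \<le> \<mu> * \<kappa>"
          unfolding abs_mult using \<mu> noise \<open>0 \<le> \<mu>\<close> by (intro mult_mono) (auto simp: m_def)
        moreover have "\<bar>(\<Sum>i<n. X \<omega> i j * \<epsilon> \<omega> i) / real n\<bar> \<le> \<kappa>" using cross[OF that] by simp
        ultimately show ?thesis unfolding eq \<delta>_eq by (rule order_trans[OF abs_triangle_ineq add_mono])
      qed
      \<comment> \<open>The two perturbations together cost at most
        \<open>16 * \<delta> = v / 3\<close>, below \<open>2 * v\<close>.\<close>
      have "real \<sigma> * \<eta> = (2 * \<mu> + 1) * \<kappa>" using \<sigma> by (simp add: \<eta>_def s_def)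
      also have "\<dots> \<le> 2 * \<delta>" using \<kappa>_pos by (simp add: \<delta>_def algebra_simps)
      finally have "real \<sigma> * \<eta> \<le> 2 * \<delta>" .
      moreover have "\<delta> = v / 48" using \<open>0 \<le> \<mu>\<close> by (simp add: \<delta>_def \<kappa> field_simps)
      ultimately show "6 * real \<sigma> * \<eta> + 4 * \<delta> < 2 * v" using v(1) by linarith
      show "0 \<le> \<eta>" using s \<open>0 \<le> \<mu>\<close> by (simp add: \<eta>_def)
    qed auto
    then show "\<omega> \<in> recovery_event n d \<sigma> D E z"
      using \<omega> by (cases \<omega>) (simp add: recovery_event_def Let_def)
  qed
  moreover have "recovery_event n d \<sigma> D E z \<in> sets P"
    by (rule sets_recovery_event[OF sets_D sets_E z(1) \<sigma>(2) z(2,3)])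
  ultimately have "measure P (space P - B) \<le> measure P (recovery_event n d \<sigma> D E z)"
    by (rule finite_measure_mono)
  then show ?thesis using prob_compl[OF B] meas_B by (simp add: z_def)
qed

end

theorem theorem10:
  shows "\<exists>c\<^sub>0>0. \<exists>K\<^sub>1 K\<^sub>2 :: real. \<exists>N :: nat.
    \<forall>v>0. \<forall>\<mu>\<ge>0. \<exists>C>0.
    \<forall>n\<ge>N. \<forall>d\<ge>N. \<forall>\<sigma> :: nat. \<forall>\<rho> :: real. \<forall>D E :: real measure. \<forall>a :: real vec.
      0 < n \<longrightarrow> 0 < d \<longrightarrow> 0 < \<sigma> \<longrightarrow> \<sigma> \<le> d \<longrightarrow> 0 \<le> \<rho> \<longrightarrow>
      subgaussian_law D 1 \<longrightarrow> v \<le> law_variance D \<longrightarrow> \<bar>law_mean D\<bar> \<le> \<mu> \<longrightarrow>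
      subgaussian_law E \<rho> \<longrightarrow> law_mean E = 0 \<longrightarrow>
      a \<in> carrier_vec \<sigma> \<longrightarrow> (\<forall>i<\<sigma>. a $ i \<in> {-1, 1}) \<longrightarrow>
      real n \<ge> C * ((real \<sigma>)\<^sup>2 + \<rho>\<^sup>2) * ln (real d) \<longrightarrow>
      measure (sample_measure n d D E) (recovery_event n d \<sigma> D E (a @\<^sub>v 0\<^sub>v (d - \<sigma>)))
        \<ge> 1 - K\<^sub>1 * (1 / real d) - K\<^sub>2 * exp (- c\<^sub>0 * real \<sigma>)"
proof (rule exI[of _ 1], intro conjI, simp, rule exI[of _ 8], rule exI[of _ 0], rule exI[of _ 0], intro allI impI)
  \<comment> \<open>The witnesses come from the failure probability \<open>8 / d\<close>, valid at
    every size: \<open>K\<^sub>1 = 8\<close>, \<open>K\<^sub>2 = 0\<close>, \<open>N = 0\<close>,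
    with rate 1. Capping \<open>v\<close> at 1 keeps \<open>\<kappa> \<le> 1\<close>, so the
    deviations are small enough for the tail bounds; the sample size constant depends on
    \<open>v\<close> and \<mu> only.\<close>
  fix v \<mu> :: real assume v: "0 < v" and \<mu>: "0 \<le> \<mu>"
  define \<kappa> where "\<kappa> = min v 1 / (48 * (\<mu> + 1))"
  have "0 < \<kappa>" using v \<mu> by (simp add: \<kappa>_def)
  then have C: "0 < 576 / \<kappa>\<^sup>2" by simp
  show "\<exists>C>0. \<forall>n\<ge>0. \<forall>d\<ge>0. \<forall>\<sigma> :: nat. \<forall>\<rho> :: real. \<forall>D E :: real measure. \<forall>a :: real vec.
      0 < n \<longrightarrow> 0 < d \<longrightarrow> 0 < \<sigma> \<longrightarrow> \<sigma> \<le> d \<longrightarrow> 0 \<le> \<rho> \<longrightarrow>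
      subgaussian_law D 1 \<longrightarrow> v \<le> law_variance D \<longrightarrow> \<bar>law_mean D\<bar> \<le> \<mu> \<longrightarrow>
      subgaussian_law E \<rho> \<longrightarrow> law_mean E = 0 \<longrightarrow>
      a \<in> carrier_vec \<sigma> \<longrightarrow> (\<forall>i<\<sigma>. a $ i \<in> {-1, 1}) \<longrightarrow>
      real n \<ge> C * ((real \<sigma>)\<^sup>2 + \<rho>\<^sup>2) * ln (real d) \<longrightarrow>
      measure (sample_measure n d D E) (recovery_event n d \<sigma> D E (a @\<^sub>v 0\<^sub>v (d - \<sigma>)))
        \<ge> 1 - 8 * (1 / real d) - 0 * exp (- 1 * real \<sigma>)"
  proof (intro exI[of _ "576 / \<kappa>\<^sup>2"] conjI C allI impI)
    fix n d \<sigma> :: nat and \<rho> :: real and D E :: "real measure" and a :: "real vec"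
    assume *: "0 < n" "0 < \<sigma>" "\<sigma> \<le> d" "0 \<le> \<rho>" "subgaussian_law D 1" "v \<le> law_variance D"
      "\<bar>law_mean D\<bar> \<le> \<mu>" "subgaussian_law E \<rho>" "law_mean E = 0" "a \<in> carrier_vec \<sigma>"
      "\<forall>i<\<sigma>. a $ i \<in> {-1, 1}" "576 / \<kappa>\<^sup>2 * ((real \<sigma>)\<^sup>2 + \<rho>\<^sup>2) * ln (real d) \<le> real n"
    interpret sample n d D E \<rho> using * v by unfold_locales auto
    have "1 - 8 / real d \<le> measure P (recovery_event n d \<sigma> D E (a @\<^sub>v 0\<^sub>v (d - \<sigma>)))"
      by (rule recovery_probability[where v = "min v 1" and \<mu> = \<mu> and \<kappa> = \<kappa>])
        (use * v in \<open>auto simp: \<kappa>_def\<close>)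
    then show "1 - 8 * (1 / real d) - 0 * exp (- 1 * real \<sigma>)
        \<le> measure P (recovery_event n d \<sigma> D E (a @\<^sub>v 0\<^sub>v (d - \<sigma>)))" by simp
  qed
qed

end
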